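(* Let $\mathcal{L}$ be a local rule (switching, or reversible insertion) with its associated tableaux operation $\mathcal{L}$, and fix complementation parameters. (a) Suppose the complementary mapping $\mathcal{L}^C$ given by $\mathcal{L}^C(P,Q)=(T,U^C)$ whenever $\mathcal{L}(P,Q^C)=(T,U)$ is well defined. Then two tableaux are $\mathcal{L}$-dual equivalent if and only if they are $\mathcal{L}^C$-dual equivalent. (b) Suppose $\mathcal{L}$ satisfies: $\mathcal{L}(P,Q)=(T,U)$ if and only if $\mathcal{L}(P^C,Q^C)=(T^C,U^C)$. Then a tableau $P$ is $\mathcal{L}$-dual equivalent to a tableau $Q$ if and only if $P^C$ is $\mathcal{L}$-dual equivalent to $Q^C$.
   Context: Partitions, horizontal strips, tableaux (chains $\alpha=\beta^0\subseteq\cdots\subseteq\beta^k$ of partitions with successive differences horizontal strips) are as usual; tableaux differing by a vertical shift are identified; $(l^i,\gamma)$ denotes $\gamma$ with $i$ parts equal to $l$ prepended. The complement of $T:\beta^0\subseteq\cdots\subseteq\beta^k$ with respect to fixed $k,l$ is $T^C:\beta^k\subseteq(l,\beta^{k-1})\subseteq\cdots\subseteq(l^k,\beta^0)$; the same $k,l$ are used for all tableaux complemented. A growth diagram is a rectangular array of partitions in which each row (read left to right) and each column (read top to bottom) is a tableau, all row tableaux having the same content and all column tableaux the same content. A switching local rule assigns to partitions $\alpha\subseteq\beta\subseteq\delta$ with $\beta/\alpha,\delta/\beta$ horizontal strips a partition $\gamma=\mathcal{L}(\alpha,\beta,\delta)$ such that $\begin{smallmatrix}\alpha&\beta\\\gamma&\delta\end{smallmatrix}$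 is a growth diagram, with $\gamma=\mathcal{L}(\alpha,\beta,\delta)\iff\beta=\mathcal{L}(\alpha,\gamma,\delta)$; its tableaux operation takes $(P,Q)$ with $Q$ extending $P$ (outer border of $P$ = inner border of $Q$), writes $P$ across the first row and $Q$ down the last column of an array, completes the growth diagram, and returns $(T,U)$ with $T$ the last row and $U$ the first column. An insertion local rule assigns to $\alpha,\beta,\gamma$ with $\beta/\alpha,\gamma/\alpha$ horizontal strips a partition $\delta=\mathcal{L}(\alpha;\beta,\gamma)$ making $\begin{smallmatrix}\alpha&\beta\\\gamma&\delta\end{smallmatrix}$ a growth diagram, symmetric in $\beta,\gamma$ and compatible with prepending a part $l$ to all three; it is reversible if for all $\beta,\gamma,\delta$ with $\delta/\beta,\delta/\gamma$ horizontal strips and $l$ at least the initial part of $\delta$ there is a unique $\alpha$ with $\mathcal{L}(\alpha;(l,\beta),(l,\gamma))=(l,\delta)$. Its tableaux operation takes $(P,Q)$ sharing an inner border, writes $P$ across the first row and $Q$ down the first column, completes the growth diagram and returns $(T,U)$ = (last row, last column); for $P,Q$ sharing an outer border it writes them across the last row and down the last column, completes using the reverse rule and returns (first row, first column). If $\mathcal{L}(P,Q)=(T,U)$, the passage $P\mapsto T$ is called an $\mathcal{L}$-move applied to $P$ (determined by $Q$). Two tableaux of the same shape are $\mathcal{L}$-dual equivalent if applying the same sequence of $\mathcal{L}$-moves to each always yields tableaux of the same shape.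
   Formalization: All tableaux, including those determining the moves, are taken to have at most l columns, k is at least 1, vertical shifts prepend rows of length l, and a sequence of moves must apply to both tableaux or to neither; for wider tableaux or k = 0 part (a) fails as literally stated. *)

theory Defs
  imports Main
begin

text \<open>
  A partition is an eventually zero weakly decreasing function, so trailing zeros are immaterial and
  the (0-based) value \<^term>\<open>\<alpha> 0\<close> is the initial part. Prepending a part \<open>l\<close> is \<^term>\<open>case_nat l\<close>.
\<close>

type_synonym part = "nat \<Rightarrow> nat"

definition is_partition :: "part \<Rightarrow> bool" where
  "is_partition \<alpha> \<longleftrightarrow> antimono \<alpha> \<and> finite {i. \<alpha> i \<noteq> 0}"

definition psize :: "part \<Rightarrow> nat" where
  "psize \<alpha> = (\<Sum>i | \<alpha> i \<noteq> 0. \<alpha> i)"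

definition prepend :: "nat \<Rightarrow> nat \<Rightarrow> part \<Rightarrow> part" where
  "prepend l i \<gamma> = (case_nat l ^^ i) \<gamma>"

text \<open>\<^term>\<open>hstrip \<alpha> \<beta>\<close>: \<open>\<alpha> \<subseteq> \<beta>\<close> and \<open>\<beta>/\<alpha>\<close> is a horizontal strip.\<close>

definition hstrip :: "part \<Rightarrow> part \<Rightarrow> bool" where
  "hstrip \<alpha> \<beta> \<longleftrightarrow> (\<forall>i. \<alpha> i \<le> \<beta> i \<and> \<beta> (Suc i) \<le> \<alpha> i)"

text \<open>
  A tableau is the list of the partitions of its chain; \<open>\<beta>\<^sup>0 \<subseteq> \<dots> \<subseteq> \<beta>\<^sup>k\<close> has length \<open>k + 1\<close>.
  Its inner border is \<open>hd\<close>, its outer border is \<open>last\<close>.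
\<close>

type_synonym tab = "part list"

definition tableau :: "tab \<Rightarrow> bool" where
  "tableau T \<longleftrightarrow> T \<noteq> [] \<and> (\<forall>\<beta>\<in>set T. is_partition \<beta>) \<and> successively hstrip T"

definition content :: "tab \<Rightarrow> nat list" where
  "content T = map2 (\<lambda>\<alpha> \<beta>. psize \<beta> - psize \<alpha>) T (tl T)"

text \<open>Tableaux with at most \<open>l\<close> columns, and those to which complementation for \<open>k, l\<close> applies.\<close>

definition tableaux_within :: "nat \<Rightarrow> tab set" where
  "tableaux_within l = {T. tableau T \<and> last T 0 \<le> l}"

definition tableaux_kl :: "nat \<Rightarrow> nat \<Rightarrow> tab set" where
  "tableaux_kl k l = {T \<in> tableaux_within l. length T = Suc k}"

definition complement :: "nat \<Rightarrow> nat \<Rightarrow> tab \<Rightarrow> tab" where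
  "complement k l T = map (\<lambda>i. prepend l i (T ! (k - i))) [0..<Suc k]"

text \<open>
  The vertical shifts compatible with complementation prepend rows of full length \<open>l\<close>; they make
  complementation an involution, since complementing twice prepends \<open>l\<^sup>k\<close> to each partition.
\<close>

definition vshift :: "nat \<Rightarrow> nat \<Rightarrow> tab \<Rightarrow> tab" where
  "vshift l i T = map (prepend l i) T"

definition shift_eq :: "nat \<Rightarrow> tab \<Rightarrow> tab \<Rightarrow> bool" where
  "shift_eq l T T' \<longleftrightarrow> (\<exists>i j. vshift l i T = vshift l j T')"

definition same_shape :: "nat \<Rightarrow> tab \<Rightarrow> tab \<Rightarrow> bool" where
  "same_shape l T T' \<longleftrightarrow> (\<exists>i j. prepend l i (hd T) = prepend l j (hd T') \<and>
                                prepend l i (last T) = prepend l j (last T'))"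

text \<open>An array is given by the list of its rows.\<close>

definition column :: "part list list \<Rightarrow> nat \<Rightarrow> tab" where
  "column G j = map (\<lambda>R. R ! j) G"

definition growth_diagram :: "part list list \<Rightarrow> bool" where
  "growth_diagram G \<longleftrightarrow> G \<noteq> [] \<and>
     (\<forall>R\<in>set G. tableau R \<and> content R = content (hd G)) \<and>
     (\<forall>j<length (hd G). tableau (column G j) \<and> content (column G j) = content (column G 0))"

text \<open>A switching rule is written \<open>\<gamma> = L \<alpha> \<beta> \<delta>\<close>, an insertion rule \<open>\<delta> = L \<alpha> \<beta> \<gamma>\<close>.\<close>

type_synonym rule = "part \<Rightarrow> part \<Rightarrow> part \<Rightarrow> part"

definition switching_rule :: "rule \<Rightarrow> bool" where
  "switching_rule L \<longleftrightarrow>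
     (\<forall>\<alpha> \<beta> \<delta>. is_partition \<alpha> \<and> is_partition \<beta> \<and> is_partition \<delta> \<and> hstrip \<alpha> \<beta> \<and> hstrip \<beta> \<delta> \<longrightarrow>
        growth_diagram [[\<alpha>, \<beta>], [L \<alpha> \<beta> \<delta>, \<delta>]]) \<and>
     (\<forall>\<alpha> \<beta> \<gamma> \<delta>. is_partition \<alpha> \<and> is_partition \<beta> \<and> is_partition \<gamma> \<and> is_partition \<delta> \<and>
        hstrip \<alpha> \<beta> \<and> hstrip \<beta> \<delta> \<and> hstrip \<alpha> \<gamma> \<and> hstrip \<gamma> \<delta> \<longrightarrow>
        (\<gamma> = L \<alpha> \<beta> \<delta> \<longleftrightarrow> \<beta> = L \<alpha> \<gamma> \<delta>))"

text \<open>
  Prepending \<open>l\<close> is demanded only where \<open>(l, \<delta>)\<close> is a partition: \<open>\<delta>\<close> may have a larger initial part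
  than \<open>\<beta>\<close> and \<open>\<gamma>\<close>, as happens for column insertion.
\<close>

definition insertion_rule :: "rule \<Rightarrow> bool" where
  "insertion_rule L \<longleftrightarrow>
     (\<forall>\<alpha> \<beta> \<gamma>. is_partition \<alpha> \<and> is_partition \<beta> \<and> is_partition \<gamma> \<and> hstrip \<alpha> \<beta> \<and> hstrip \<alpha> \<gamma> \<longrightarrow>
        growth_diagram [[\<alpha>, \<beta>], [\<gamma>, L \<alpha> \<beta> \<gamma>]] \<and>
        L \<alpha> \<beta> \<gamma> = L \<alpha> \<gamma> \<beta> \<and>
        (\<forall>l. L \<alpha> \<beta> \<gamma> 0 \<le> l \<longrightarrow>
           L (case_nat l \<alpha>) (case_nat l \<beta>) (case_nat l \<gamma>) = case_nat l (L \<alpha> \<beta> \<gamma>)))"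

definition reversible :: "rule \<Rightarrow> bool" where
  "reversible L \<longleftrightarrow>
     (\<forall>\<beta> \<gamma> \<delta> l. is_partition \<beta> \<and> is_partition \<gamma> \<and> is_partition \<delta> \<and> hstrip \<beta> \<delta> \<and> hstrip \<gamma> \<delta> \<and> \<delta> 0 \<le> l \<longrightarrow>
        (\<exists>!\<alpha>. is_partition \<alpha> \<and> hstrip \<alpha> (case_nat l \<beta>) \<and> hstrip \<alpha> (case_nat l \<gamma>) \<and>
              L \<alpha> (case_nat l \<beta>) (case_nat l \<gamma>) = case_nat l \<delta>))"

text \<open>
  \<open>array L P Q T U\<close>: some growth diagram obeying the rule in every cell has \<open>P, Q\<close> on the two sides
  it is completed from and \<open>T, U\<close> on the other two.
\<close>

definition switching_array :: "rule \<Rightarrow> tab \<Rightarrow> tab \<Rightarrow> tab \<Rightarrow> tab \<Rightarrow> bool" where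
  "switching_array L P Q T U \<longleftrightarrow> (\<exists>G. growth_diagram G \<and>
     (\<forall>i j. Suc i < length G \<and> Suc j < length (hd G) \<longrightarrow>
        G ! Suc i ! j = L (G ! i ! j) (G ! i ! Suc j) (G ! Suc i ! Suc j)) \<and>
     hd G = P \<and> map last G = Q \<and> last G = T \<and> map hd G = U)"

definition insertion_array :: "rule \<Rightarrow> tab \<Rightarrow> tab \<Rightarrow> tab \<Rightarrow> tab \<Rightarrow> bool" where
  "insertion_array L P Q T U \<longleftrightarrow> (\<exists>G. growth_diagram G \<and>
     (\<forall>i j. Suc i < length G \<and> Suc j < length (hd G) \<longrightarrow>
        G ! Suc i ! Suc j = L (G ! i ! j) (G ! i ! Suc j) (G ! Suc i ! j)) \<and>
     hd G = P \<and> map hd G = Q \<and> last G = T \<and> map last G = U)"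

text \<open>
  Operations are relations, \<open>F d P Q T U\<close> meaning \<open>F(P, Q) = (T, U)\<close>, on tableaux with at most \<open>l\<close>
  columns up to vertical shift; the latter supplies the rows of length \<open>l\<close> needed by the reverse of
  an insertion rule. The direction tells apart the two ways of completing an array, because a pair
  of tableaux can meet the border conditions of both (for insertion: any pair of the same shape).

  \<open>Forward\<close>: switching with \<open>Q\<close> extending \<open>P\<close>; insertion with \<open>P, Q\<close> sharing an inner border.
  \<open>Backward\<close> completes the same arrays from the opposite sides: switching with \<open>P\<close> extending \<open>Q\<close>
  (\<open>P\<close> the last row, \<open>Q\<close> the first column); insertion with \<open>P, Q\<close> sharing an outer border.
\<close>

datatype direction = Forward | Backward

fun opposite :: "direction \<Rightarrow> direction" where
  "opposite Forward = Backward"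
| "opposite Backward = Forward"

type_synonym operation = "direction \<Rightarrow> tab \<Rightarrow> tab \<Rightarrow> tab \<Rightarrow> tab \<Rightarrow> bool"

definition up_to_shift ::
  "nat \<Rightarrow> (tab \<Rightarrow> tab \<Rightarrow> tab \<Rightarrow> tab \<Rightarrow> bool) \<Rightarrow> tab \<Rightarrow> tab \<Rightarrow> tab \<Rightarrow> tab \<Rightarrow> bool" where
  "up_to_shift l A P Q T U \<longleftrightarrow>
     {P, Q, T, U} \<subseteq> tableaux_within l \<and>
     (\<exists>P' Q' T' U'. shift_eq l P P' \<and> shift_eq l Q Q' \<and> shift_eq l T T' \<and> shift_eq l U U' \<and>
        A P' Q' T' U')"

fun switching_op :: "nat \<Rightarrow> rule \<Rightarrow> operation" where
  "switching_op l L Forward P Q T U = up_to_shift l (switching_array L) P Q T U"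
| "switching_op l L Backward P Q T U = up_to_shift l (switching_array L) T U P Q"

text \<open>
  The one-sided version of switching, allowing only \<open>Q\<close> extending \<open>P\<close>. As complementation exchanges
  inner and outer borders, symmetry of a switching operation under complementation is a sensible
  condition for \<^const>\<open>switching_op\<close> only.
\<close>

definition outward_switching_op :: "nat \<Rightarrow> rule \<Rightarrow> operation" where
  "outward_switching_op l L d P Q T U \<longleftrightarrow> d = Forward \<and> switching_op l L d P Q T U"

fun insertion_op :: "nat \<Rightarrow> rule \<Rightarrow> operation" where
  "insertion_op l L Forward P Q T U = up_to_shift l (insertion_array L) P Q T U"
| "insertion_op l L Backward P Q T U = up_to_shift l (insertion_array L) T U P Q"

definition local_rule_operation :: "nat \<Rightarrow> operation \<Rightarrow> bool" where
  "local_rule_operation l F \<longleftrightarrow>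
     (\<exists>L. switching_rule L \<and> (F = switching_op l L \<or> F = outward_switching_op l L)) \<or>
     (\<exists>L. insertion_rule L \<and> reversible L \<and> F = insertion_op l L)"

definition complementary_op :: "nat \<Rightarrow> nat \<Rightarrow> operation \<Rightarrow> operation" where
  "complementary_op k l F d P Q T V \<longleftrightarrow>
     Q \<in> tableaux_kl k l \<and> (\<exists>U. F d P (complement k l Q) T U \<and> shift_eq l V (complement k l U))"

definition well_defined_op :: "nat \<Rightarrow> operation \<Rightarrow> bool" where
  "well_defined_op l F \<longleftrightarrow>
     (\<forall>d P Q T U P' Q' T' U'. shift_eq l P P' \<and> shift_eq l Q Q' \<and> F d P Q T U \<and> F d P' Q' T' U' \<longrightarrow>
        shift_eq l T T' \<and> shift_eq l U U')"

fun apply_moves :: "operation \<Rightarrow> (direction \<times> tab) list \<Rightarrow> tab \<Rightarrow> tab \<Rightarrow> bool" where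
  "apply_moves F [] P T \<longleftrightarrow> T = P"
| "apply_moves F ((d, Q) # ms) P T \<longleftrightarrow> (\<exists>S U. F d P Q S U \<and> apply_moves F ms S T)"

text \<open>
  A sequence of moves leading out of the tableaux with at most \<open>l\<close> columns from one tableau but not
  from the other yields different shapes, whence the condition on existence.
\<close>

definition dual_equivalent :: "nat \<Rightarrow> operation \<Rightarrow> tab \<Rightarrow> tab \<Rightarrow> bool" where
  "dual_equivalent l F P P' \<longleftrightarrow> same_shape l P P' \<and>
     (\<forall>ms. ((\<exists>T. apply_moves F ms P T) \<longleftrightarrow> (\<exists>T'. apply_moves F ms P' T')) \<and>
           (\<forall>T T'. apply_moves F ms P T \<and> apply_moves F ms P' T' \<longrightarrow> same_shape l T T'))"

end

theory Submission imports Defs begin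

text \<open>
  Dual equivalence does not change when only moves along tableaux \<open>\<beta>\<^sup>0 \<subseteq> \<dots> \<subseteq> \<beta>\<^sup>k\<close> of the fixed
  length \<open>k + 1\<close> are allowed. A move along a tableau \<open>Q\<close> is the succession of the moves along the
  pairs of consecutive partitions of \<open>Q\<close>, and each pair can be padded to length \<open>k + 1\<close> by repeating
  its outer partition, because a cell with two equal horizontal neighbours or two equal vertical
  neighbours is forced by the contents. Hence the shapes reached by arbitrary moves are controlled by
  the moves of length \<open>k + 1\<close>. Existence of a move is controlled as well: for a switching rule it
  depends only on the shape, and for an insertion rule the arrays of the pieces can be glued, since
  the rule commutes with the vertical shifts.

  Complementation maps the tableaux of length \<open>k + 1\<close> to themselves and is an involution up to
  vertical shift. The moves of \<open>\<L>\<^sup>C\<close> are therefore exactly the moves of \<open>\<L>\<close> along tableaux of length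
  \<open>k + 1\<close>; and under the symmetry of (b), complementing all tableaux of a sequence of such moves gives
  a sequence of moves from \<open>P\<^sup>C\<close>.
\<close>

section \<open>Partitions\<close>

lemma support_case_nat: "{i. case_nat l a i \<noteq> 0} \<subseteq> insert 0 (Suc ` {i. a i \<noteq> (0::nat)})"
proof
  fix i assume "i \<in> {i. case_nat l a i \<noteq> 0}"
  then show "i \<in> insert 0 (Suc ` {i. a i \<noteq> 0})" by (cases i) auto
qed

lemma is_partition_case_nat: "is_partition (case_nat l a) \<longleftrightarrow> is_partition a \<and> a 0 \<le> l"
proof -
  have "Suc ` {i. a i \<noteq> 0} \<subseteq> {i. case_nat l a i \<noteq> 0}"
    by auto
  then have "finite {i. case_nat l a i \<noteq> 0} \<longleftrightarrow> finite {i. a i \<noteq> 0}"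
    using support_case_nat[of l a]
    by (metis finite_imageD finite_imageI finite_insert finite_subset inj_Suc)
  moreover have "antimono (case_nat l a) \<longleftrightarrow> antimono a \<and> a 0 \<le> l"
    unfolding antimono_iff_le_Suc
    by (auto split: nat.splits)
  ultimately show ?thesis
    by (auto simp: is_partition_def)
qed

lemma hstrip_case_nat:
  "hstrip (case_nat l a) (case_nat l b) \<longleftrightarrow> hstrip a b \<and> b 0 \<le> l"
  unfolding hstrip_def
  by (auto split: nat.splits)

lemma hstrip_refl: "is_partition a \<Longrightarrow> hstrip a a"
  by (auto simp: hstrip_def is_partition_def antimono_iff_le_Suc)

lemma hstrip_first: "hstrip a b \<Longrightarrow> a 0 \<le> b 0"
  by (auto simp: hstrip_def)

lemma psize_superset:
  assumes "finite A" and "{i. a i \<noteq> 0} \<subseteq> A"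
  shows "psize a = sum a A"
  unfolding psize_def using assms by (intro sum.mono_neutral_left) auto

lemma psize_case_nat:
  assumes "is_partition a"
  shows "psize (case_nat l a) = l + psize a"
proof -
  let ?A = "{i. a i \<noteq> 0}"
  have fin: "finite ?A" using assms by (simp add: is_partition_def)
  have "psize (case_nat l a) = sum (case_nat l a) (insert 0 (Suc ` ?A))"
    by (rule psize_superset[OF _ support_case_nat]) (use fin in simp)
  also have "\<dots> = l + sum (case_nat l a) (Suc ` ?A)"
    using fin by simp
  also have "sum (case_nat l a) (Suc ` ?A) = psize a"
    by (simp add: sum.reindex psize_def)
  finally show ?thesis .
qed

text \<open>Contents are truncated differences, so the last hypothesis only bounds
  \<open>psize b\<close> by \<open>psize a\<close>; a proper inclusion would make \<open>b\<close>
  strictly larger. All arguments that a cell is forced by its contents rest on this.\<close>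

lemma hstrip_psize_eq:
  assumes "is_partition a" "is_partition b" "hstrip a b" "psize b - psize a = 0"
  shows "a = b"
proof (rule ccontr)
  assume "a \<noteq> b"
  let ?B = "{i. b i \<noteq> 0}"
  have le: "a i \<le> b i" for i using assms(3) by (simp add: hstrip_def)
  obtain i where i: "a i < b i"
    using \<open>a \<noteq> b\<close> le by (metis ext le_neq_implies_less)
  have fin: "finite ?B" using assms(2) by (simp add: is_partition_def)
  have "i \<in> ?B" using i by simp
  have sub: "{i. a i \<noteq> 0} \<subseteq> ?B" using le by (metis (mono_tags) Collect_mono le_zero_eq)
  have "sum a ?B < sum b ?B"
    using fin le i \<open>i \<in> ?B\<close> by (intro sum_strict_mono_ex1) blast+
  then show False
    using assms(4) psize_superset[OF fin sub] psize_superset[OF fin, of b] by auto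
qed

section \<open>Tableaux up to vertical shift\<close>

lemma prepend_0 [simp]: "prepend l 0 a = a"
  by (simp add: prepend_def)

lemma prepend_Suc: "prepend l (Suc i) a = case_nat l (prepend l i a)"
  by (simp add: prepend_def)

lemma prepend_prepend: "prepend l i (prepend l j a) = prepend l (i + j) a"
  by (simp add: prepend_def funpow_add)

lemma prepend_inject [simp]: "prepend l i a = prepend l i b \<longleftrightarrow> a = b"
proof (induction i)
  case (Suc i)
  have "case_nat l c = case_nat l d \<longleftrightarrow> c = d" for c d :: part
    by (metis (no_types) ext old.nat.simps(5))
  then show ?case by (simp add: prepend_Suc Suc)
qed simp

text \<open>Two different amounts would make \<open>a\<close> agree with a copy of itself moved down
  below rows of length \<open>l\<close>. Then every part of \<open>a\<close> would be
  \<open>l > 0\<close>, against finite support.\<close>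

lemma prepend_amount_inject:
  assumes "is_partition a" and "0 < l" and "prepend l i a = prepend l j a"
  shows "i = j"
proof (rule ccontr)
  assume "i \<noteq> j"
  have "prepend l m a = (\<lambda>n. if n < m then l else a (n - m))" for m
    by (induction m) (auto simp: prepend_Suc fun_eq_iff split: nat.split)
  then have shifted: "(if n < i then l else a (n - i)) = (if n < j then l else a (n - j))" for n
    using assms(3) by metis
  \<comment> \<open>Both sides are read at \<open>n + p\<close>: below \<open>q\<close> the right
    side is \<open>l\<close>, from \<open>q\<close> on it is the part of \<open>a\<close> that
    stands \<open>q - p\<close> places earlier.\<close>
  have full: "a n = l" if "p < q" "\<And>n. (if n < p then l else a (n - p)) = (if n < q then l else a (n - q))"
    for n p q :: nat
  proof (induction n rule: less_induct)
    case (less n)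
    show ?case
    proof (cases "n + p < q")
      case True
      then show ?thesis using that(2)[of "n + p"] by simp
    next
      case False
      then have "a n = a (n + p - q)" using that(2)[of "n + p"] by simp
      moreover have "n + p - q < n" using False that(1) by linarith
      ultimately show ?thesis using less by simp
    qed
  qed
  have "a n = l" for n
    using \<open>i \<noteq> j\<close> full[of i j n] full[of j i n] shifted by (metis nat_neq_iff)
  then show False using assms(1,2) by (simp add: is_partition_def)
qed

text \<open>Initial parts grow along horizontal strips, so the bound on the outer border holds for
  the whole chain. In this pointwise form it survives cutting, gluing and shifting.\<close>

lemma tableaux_within_iff:
  "T \<in> tableaux_within l \<longleftrightarrow>
     T \<noteq> [] \<and> (\<forall>\<beta>\<in>set T. is_partition \<beta> \<and> \<beta> 0 \<le> l) \<and> successively hstrip T"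
proof -
  have "\<forall>\<beta>\<in>set T. \<beta> 0 \<le> last T 0" if "successively hstrip T"
    using that
  proof (induction T rule: rev_induct)
    case (snoc a T)
    then show ?case
      by (cases "T = []") (fastforce simp: successively_append_iff dest: hstrip_first)+
  qed simp
  then show ?thesis
    unfolding tableaux_within_def tableau_def using last_in_set order_trans by blast
qed

lemma vshift_0 [simp]: "vshift l 0 T = T"
  by (simp add: vshift_def map_idI)

lemma vshift_vshift: "vshift l i (vshift l j T) = vshift l (i + j) T"
  by (simp add: vshift_def prepend_prepend)

lemma vshift_Suc: "vshift l (Suc i) T = vshift l 1 (vshift l i T)"
  by (simp add: vshift_vshift)

lemma vshift_one: "vshift l (Suc 0) T = map (case_nat l) T"
  by (simp add: vshift_def prepend_Suc fun_eq_iff)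

lemma vshift_append: "vshift l i (S @ T) = vshift l i S @ vshift l i T"
  by (simp add: vshift_def)

lemma length_vshift [simp]: "length (vshift l i T) = length T"
  by (simp add: vshift_def)

lemma hd_vshift: "T \<noteq> [] \<Longrightarrow> hd (vshift l i T) = prepend l i (hd T)"
  by (simp add: vshift_def hd_map)

lemma last_vshift: "T \<noteq> [] \<Longrightarrow> last (vshift l i T) = prepend l i (last T)"
  by (simp add: vshift_def last_map)

lemma vshift_within: "vshift l i T \<in> tableaux_within l \<longleftrightarrow> T \<in> tableaux_within l"
proof (induction i)
  case (Suc i)
  have "map (case_nat l) S \<in> tableaux_within l \<longleftrightarrow> S \<in> tableaux_within l" for S
    unfolding tableaux_within_iff
    by (auto simp: successively_map is_partition_case_nat hstrip_case_nat elim: successively_mono)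
  then show ?case
    by (subst vshift_Suc) (simp add: vshift_one Suc)
qed simp

lemma shift_eq_refl [simp]: "shift_eq l T T"
  unfolding shift_eq_def by blast

lemma shift_eq_vshift [simp]: "shift_eq l T (vshift l i T)"
  unfolding shift_eq_def by (metis vshift_0)

lemma shift_eq_sym: "shift_eq l S T \<Longrightarrow> shift_eq l T S"
  unfolding shift_eq_def by metis

lemma shift_eq_trans:
  assumes "shift_eq l R S" "shift_eq l S T"
  shows "shift_eq l R T"
proof -
  obtain a b c d where "vshift l a R = vshift l b S" "vshift l c S = vshift l d T"
    using assms unfolding shift_eq_def by blast
  \<comment> \<open>Adding the amounts crosswise makes both equations meet in the same shift of
    \<open>S\<close>.\<close>
  then have "vshift l (c + a) R = vshift l (b + d) T"
    by (metis vshift_vshift add.commute)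
  then show ?thesis unfolding shift_eq_def by blast
qed

lemma shift_eq_length: "shift_eq l S T \<Longrightarrow> length S = length T"
  unfolding shift_eq_def by (metis length_vshift)

lemma shift_eq_within: "shift_eq l S T \<Longrightarrow> S \<in> tableaux_within l \<longleftrightarrow> T \<in> tableaux_within l"
  unfolding shift_eq_def by (metis vshift_within)

lemma shift_eq_same_shape:
  assumes "shift_eq l S T" "S \<noteq> []"
  shows "same_shape l S T"
  using assms shift_eq_length[OF assms(1)]
  unfolding shift_eq_def same_shape_def by (metis hd_vshift last_vshift length_0_conv)

lemma same_shape_sym: "same_shape l S T \<Longrightarrow> same_shape l T S"
  unfolding same_shape_def by metis

lemma same_shape_trans:
  assumes "same_shape l R S" "same_shape l S T"
  shows "same_shape l R T"
proof -
  obtain a b c d where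
    "prepend l a (hd R) = prepend l b (hd S)" "prepend l a (last R) = prepend l b (last S)"
    "prepend l c (hd S) = prepend l d (hd T)" "prepend l c (last S) = prepend l d (last T)"
    using assms unfolding same_shape_def by blast
  then have "prepend l (c + a) (hd R) = prepend l (b + d) (hd T)"
    "prepend l (c + a) (last R) = prepend l (b + d) (last T)"
    by (metis prepend_prepend add.commute)+
  then show ?thesis unfolding same_shape_def by blast
qed

lemma shift_eq_appendD:
  assumes "shift_eq l (S @ T) (S' @ T')" "length S = length S'"
  shows "shift_eq l S S'" "shift_eq l T T'"
  using assms unfolding shift_eq_def by (auto simp: vshift_append)

lemma shift_eq_repeatD:
  assumes "shift_eq l (S @ a # a # T) (S' @ a' # b' # T')" "length S = length S'"
  shows "a' = b'" "shift_eq l (S @ a # T) (S' @ a' # T')"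
  using assms unfolding shift_eq_def by (auto simp: vshift_def)

lemma shift_eq_repeatI:
  assumes "shift_eq l (S @ a # T) (S' @ a' # T')" "length S = length S'"
  shows "shift_eq l (S @ a # a # T) (S' @ a' # a' # T')"
  using assms unfolding shift_eq_def by (auto simp: vshift_def)

lemma within_append:
  "S @ a # T \<in> tableaux_within l \<longleftrightarrow> S @ [a] \<in> tableaux_within l \<and> a # T \<in> tableaux_within l"
  by (auto simp: tableaux_within_iff successively_append_iff)

lemma within_repeat: "S @ a # a # T \<in> tableaux_within l \<longleftrightarrow> S @ a # T \<in> tableaux_within l"
  by (auto simp: tableaux_within_iff successively_append_iff successively_Cons hstrip_refl)

text \<open>The common partition forces the two shifts to agree: for \<open>l > 0\<close> it differs from its shifts.\<close>

lemma shift_eq_join: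
  assumes "shift_eq l (S @ [a]) (S' @ [a'])" "shift_eq l (a # T) (a' # T')"
    and "S @ [a] \<in> tableaux_within l" "a # T \<in> tableaux_within l"
  shows "shift_eq l (S @ a # T) (S' @ a' # T')"
proof -
  obtain i j m n where 0: "vshift l i (S @ [a]) = vshift l j (S' @ [a'])"
    "vshift l m (a # T) = vshift l n (a' # T')"
    using assms unfolding shift_eq_def by blast
  \<comment> \<open>Both primed sides are brought to the common amount \<open>r\<close>; then
    prepending \<open>p\<close> or \<open>q\<close> rows to \<open>a\<close> gives the same
    partition.\<close>
  define p q r where "p = i + n" and "q = m + j" and "r = n + j"
  have 1: "vshift l p (S @ [a]) = vshift l r (S' @ [a'])"
    "vshift l q (a # T) = vshift l r (a' # T')"
    using 0 unfolding p_def q_def r_def by (metis vshift_vshift add.commute)+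
  have part: "is_partition a" "a 0 \<le> l" using assms by (auto simp: tableaux_within_iff)
  have "prepend l p a = prepend l q a"
    using 1 by (simp add: vshift_def)
  \<comment> \<open>For \<open>l = 0\<close> the amounts \<open>p\<close> and \<open>q\<close> may
    differ, but then all partitions are zero and shifts leave them fixed.\<close>
  moreover have "vshift 0 e R = R" if "R \<in> tableaux_within 0" for e and R
  proof -
    have "prepend 0 e b = b" if "is_partition b" "b 0 \<le> 0" for b
    proof (induction e)
      case (Suc e)
      have "b n = 0" for n
        using that unfolding is_partition_def by (metis antimonoD bot_nat_0.extremum le_zero_eq)
      then have "case_nat 0 b = b" by (auto split: nat.split)
      then show ?case using Suc by (simp add: prepend_Suc)
    qed simp
    then show ?thesis
      using that by (auto simp: vshift_def tableaux_within_iff intro!: map_idI)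
  qed
  ultimately have "vshift l q (a # T) = vshift l p (a # T)"
    using prepend_amount_inject[OF part(1), of l p q] assms(4) by (cases "l = 0") auto
  with 1 have "vshift l p (S @ a # T) = vshift l r (S' @ a' # T')"
    by (simp add: vshift_def)
  then show ?thesis unfolding shift_eq_def by blast
qed

section \<open>Growth diagrams row by row\<close>

text \<open>The predicate \<open>C\<close> receives the upper left, upper right, lower left and
  lower right partition of a cell, so that switching and insertion rules are treated at once.
  Contents are compared between neighbours only.\<close>

definition step :: "(part \<Rightarrow> part \<Rightarrow> part \<Rightarrow> part \<Rightarrow> bool) \<Rightarrow> tab \<Rightarrow> tab \<Rightarrow> bool" where
  "step C R R' \<longleftrightarrow> length R' = length R \<and>
     (\<forall>j<length R. hstrip (R ! j) (R' ! j)) \<and>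
     (\<forall>j. Suc j < length R \<longrightarrow>
        psize (R ! Suc j) - psize (R ! j) = psize (R' ! Suc j) - psize (R' ! j) \<and>
        psize (R' ! Suc j) - psize (R ! Suc j) = psize (R' ! j) - psize (R ! j) \<and>
        C (R ! j) (R ! Suc j) (R' ! j) (R' ! Suc j))"

definition diagram :: "(part \<Rightarrow> part \<Rightarrow> part \<Rightarrow> part \<Rightarrow> bool) \<Rightarrow> part list list \<Rightarrow> bool" where
  "diagram C G \<longleftrightarrow> G \<noteq> [] \<and> (\<forall>R\<in>set G. tableau R) \<and> successively (step C) G"

text \<open>Non-emptiness makes the lengths recoverable: the empty list and a list with one
  partition both have empty content.\<close>

lemma content_eq_iff:
  assumes "T \<noteq> []" "T' \<noteq> []"
  shows "content T = content T' \<longleftrightarrow> length T = length T' \<and>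
    (\<forall>j. Suc j < length T \<longrightarrow> psize (T ! Suc j) - psize (T ! j) = psize (T' ! Suc j) - psize (T' ! j))"
proof -
  have len: "length (content S) = length S - 1" for S
    by (simp add: content_def)
  have nth: "content S ! j = psize (S ! Suc j) - psize (S ! j)" if "Suc j < length S" for S j
    using that by (simp add: content_def nth_tl)
  have "length T = length T' \<longleftrightarrow> length (content T) = length (content T')"
    using assms by (cases T; cases T') (simp_all add: len)
  moreover have "content T = content T' \<longleftrightarrow> length (content T) = length (content T') \<and>
      (\<forall>j<length T - 1. content T ! j = content T' ! j)"
    by (simp add: list_eq_iff_nth_eq len)
  moreover have "j < length T - 1 \<longleftrightarrow> Suc j < length T" for j
    by auto
  ultimately show ?thesis
    by (auto simp: nth)
qed

lemma step_column_content:
  assumes "step C R R'" "j < length R"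
  shows "psize (R' ! j) - psize (R ! j) = psize (R' ! 0) - psize (R ! 0)"
  using assms(2) assms(1) by (induction j) (auto simp: step_def)

text \<open>\<open>growth_diagram\<close> compares every row and column with the first one; the
  equalities between neighbours in \<open>step\<close> chain up to that. The row by row form allows
  diagrams to be cut and extended.\<close>

lemma diagram_iff:
  "diagram C G \<longleftrightarrow> growth_diagram G \<and>
     (\<forall>i j. Suc i < length G \<and> Suc j < length (hd G) \<longrightarrow>
        C (G ! i ! j) (G ! i ! Suc j) (G ! Suc i ! j) (G ! Suc i ! Suc j))"
    (is "_ \<longleftrightarrow> _ \<and> ?cells")
proof
  assume D: "diagram C G"
  then have ne: "G \<noteq> []" and tab: "\<And>i. i < length G \<Longrightarrow> tableau (G ! i)"
    and st: "\<And>i. Suc i < length G \<Longrightarrow> step C (G ! i) (G ! Suc i)"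
    by (auto simp: diagram_def successively_conv_nth)
  have rowne: "G ! i \<noteq> []" if "i < length G" for i
    using tab[OF that] by (simp add: tableau_def)
  have row: "length (G ! i) = length (hd G) \<and> content (G ! i) = content (hd G)" if "i < length G" for i
    using that
  proof (induction i)
    case (Suc i)
    have "content (G ! i) = content (G ! Suc i)"
      using st[OF Suc.prems] rowne Suc.prems by (subst content_eq_iff) (auto simp: step_def)
    then show ?case using Suc st[OF Suc.prems] by (auto simp: step_def)
  qed (use ne in \<open>simp add: hd_conv_nth\<close>)
  have col: "tableau (column G j) \<and> content (column G j) = content (column G 0)"
    if j: "j < length (hd G)" for j
  proof
    show "tableau (column G j)"
      unfolding tableau_def
    proof (intro conjI ballI)
      show "column G j \<noteq> []" using ne by (simp add: column_def)
      show "is_partition \<beta>" if \<beta>: "\<beta> \<in> set (column G j)" for \<beta>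
      proof -
        obtain i where i: "i < length G" "\<beta> = G ! i ! j"
          using \<beta> by (auto simp: column_def in_set_conv_nth)
        then have "\<beta> \<in> set (G ! i)" using row[of i] j by simp
        then show ?thesis using tab[OF i(1)] by (simp add: tableau_def)
      qed
      show "successively hstrip (column G j)"
        using st row j by (auto simp: column_def successively_conv_nth step_def)
    qed
    show "content (column G j) = content (column G 0)"
      using ne step_column_content[OF st] row j by (subst content_eq_iff) (auto simp: column_def)
  qed
  have ?cells using st row by (auto simp: step_def)
  moreover have "tableau R \<and> content R = content (hd G)" if "R \<in> set G" for R
    using that row tab by (auto simp: in_set_conv_nth)
  ultimately show "growth_diagram G \<and> ?cells"
    unfolding growth_diagram_def using col ne by blast
next
  assume G: "growth_diagram G \<and> ?cells"
  then have ne: "G \<noteq> []" and tab: "\<And>i. i < length G \<Longrightarrow> tableau (G ! i)"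
    and row: "\<And>i. i < length G \<Longrightarrow> content (G ! i) = content (hd G)"
    and colt: "\<And>j. j < length (hd G) \<Longrightarrow> tableau (column G j)"
    and colc: "\<And>j. j < length (hd G) \<Longrightarrow> content (column G j) = content (column G 0)"
    unfolding growth_diagram_def by (blast intro: nth_mem)+
  have rowne: "G ! i \<noteq> []" if "i < length G" for i
    using tab[OF that] by (simp add: tableau_def)
  have hdne: "hd G \<noteq> []" using rowne[of 0] ne by (simp add: hd_conv_nth)
  have len: "length (G ! i) = length (hd G)" if "i < length G" for i
    using row[OF that] content_eq_iff[OF rowne[OF that] hdne] by simp
  have "step C (G ! i) (G ! Suc i)" if i: "Suc i < length G" for i
    unfolding step_def
  proof (intro conjI allI impI)
    show "length (G ! Suc i) = length (G ! i)" using len i by simp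
    show "hstrip (G ! i ! j) (G ! Suc i ! j)" if "j < length (G ! i)" for j
      using colt[of j] that len i by (auto simp: tableau_def column_def successively_conv_nth)
  next
    fix j assume j: "Suc j < length (G ! i)"
    have "content (G ! i) = content (G ! Suc i)" using row i by simp
    then show "psize (G ! i ! Suc j) - psize (G ! i ! j) = psize (G ! Suc i ! Suc j) - psize (G ! Suc i ! j)"
      using j rowne i by (simp add: content_eq_iff)
    have "content (column G (Suc j)) = content (column G j)"
      using colc[of j] colc[of "Suc j"] j len[of i] i by (metis Suc_lessD)
    moreover have "column G j \<noteq> []" "column G (Suc j) \<noteq> []" using ne by (auto simp: column_def)
    ultimately show "psize (G ! Suc i ! Suc j) - psize (G ! i ! Suc j) = psize (G ! Suc i ! j) - psize (G ! i ! j)"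
      using i by (simp add: content_eq_iff column_def)
    show "C (G ! i ! j) (G ! i ! Suc j) (G ! Suc i ! j) (G ! Suc i ! Suc j)"
      using G i j len by simp
  qed
  with ne tab show "diagram C G"
    by (auto simp: diagram_def successively_conv_nth in_set_conv_nth)
qed

lemma growth_diagram_cell:
  "growth_diagram [[\<alpha>, \<beta>], [\<gamma>, \<delta>]] \<longleftrightarrow>
     is_partition \<alpha> \<and> is_partition \<beta> \<and> is_partition \<gamma> \<and> is_partition \<delta> \<and>
     hstrip \<alpha> \<beta> \<and> hstrip \<gamma> \<delta> \<and> hstrip \<alpha> \<gamma> \<and> hstrip \<beta> \<delta> \<and>
     psize \<beta> - psize \<alpha> = psize \<delta> - psize \<gamma> \<and> psize \<delta> - psize \<beta> = psize \<gamma> - psize \<alpha>"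
  using diagram_iff[of "\<lambda>_ _ _ _. True" "[[\<alpha>, \<beta>], [\<gamma>, \<delta>]]"]
  by (auto simp: diagram_def step_def tableau_def less_Suc_eq)

lemma step_Cons:
  "step C (\<alpha> # \<beta> # R) (\<gamma> # \<delta> # R') \<longleftrightarrow>
     hstrip \<alpha> \<gamma> \<and> psize \<beta> - psize \<alpha> = psize \<delta> - psize \<gamma> \<and> psize \<delta> - psize \<beta> = psize \<gamma> - psize \<alpha> \<and>
     C \<alpha> \<beta> \<gamma> \<delta> \<and> step C (\<beta> # R) (\<delta> # R')"
  unfolding step_def by (auto simp: All_less_Suc2)

lemma step_single: "step C [\<alpha>] R' \<longleftrightarrow> (\<exists>\<gamma>. R' = [\<gamma>] \<and> hstrip \<alpha> \<gamma>)"
  unfolding step_def by (cases R') auto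

text \<open>Agreement in one column means that this column has content zero between the two rows.
  All columns have the same content, so every partition is repeated.\<close>

lemma step_repeated_column:
  assumes "step C R R'" "tableau R" "tableau R'" "j < length R" "R ! j = R' ! j"
  shows "R = R'"
proof -
  have len: "length R' = length R" using assms by (simp add: step_def)
  have "R ! i = R' ! i" if i: "i < length R" for i
  proof (rule hstrip_psize_eq)
    show "is_partition (R ! i)" "is_partition (R' ! i)" "hstrip (R ! i) (R' ! i)"
      using assms i len by (auto simp: tableau_def step_def)
    show "psize (R' ! i) - psize (R ! i) = 0"
      using step_column_content[OF assms(1) i] step_column_content[OF assms(1,4)] assms(5) by simp
  qed
  then show ?thesis using len by (simp add: list_eq_iff_nth_eq)
qed

text \<open>The hypothesis on \<open>C\<close> is the degenerate cell with two equal rows, which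
  both kinds of local rule admit.\<close>

lemma step_refl:
  assumes "\<And>a b. \<lbrakk>is_partition a; is_partition b; hstrip a b\<rbrakk> \<Longrightarrow> C a b a b" and "tableau R"
  shows "step C R R"
  using assms by (auto simp: step_def tableau_def successively_conv_nth hstrip_refl)

lemma diagram_append:
  "diagram C (G @ R # H) \<longleftrightarrow> diagram C (G @ [R]) \<and> diagram C (R # H)"
  by (auto simp: diagram_def successively_append_iff)

section \<open>Borders and column bounds of a diagram\<close>

lemma diagram_length:
  assumes "diagram C G" "R \<in> set G"
  shows "length R = length (hd G)"
proof -
  have "growth_diagram G" using assms by (simp add: diagram_iff)
  then have "content R = content (hd G)" "R \<noteq> []" "hd G \<noteq> []"
    using assms(2) unfolding growth_diagram_def tableau_def by (blast intro: hd_in_set)+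
  then show ?thesis using content_eq_iff by blast
qed

text \<open>Either vertical border is a column with a fixed index, so left and right borders need no
  separate treatment.\<close>

lemma diagram_border:
  assumes "diagram C G" "e = hd \<or> e = last"
  obtains j where "j < length (hd G)" "\<And>R. R \<in> set G \<Longrightarrow> e R = R ! j"
proof -
  have ne: "R \<noteq> []" if "R \<in> set G" for R using assms that by (auto simp: diagram_def tableau_def)
  then have "length (hd G) > 0" using assms(1) by (simp add: diagram_def)
  then show ?thesis
    using assms(2) that[of 0] that[of "length (hd G) - 1"] ne
    by (elim disjE) (simp_all add: hd_conv_nth last_conv_nth diagram_length[OF assms(1)])
qed

lemma diagram_border_tableau:
  assumes "diagram C G" "e = hd \<or> e = last"
  shows "tableau (map e G)"
proof -
  obtain j where j: "j < length (hd G)" "\<And>R. R \<in> set G \<Longrightarrow> e R = R ! j"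
    using diagram_border[OF assms] by blast
  then have "map e G = column G j" by (simp add: column_def)
  moreover have "growth_diagram G" using assms(1) by (simp add: diagram_iff)
  ultimately show ?thesis using j(1) unfolding growth_diagram_def by metis
qed

text \<open>The lower right partition has the largest initial part: the bound passes up the last
  column and then along each row.\<close>

lemma diagram_within:
  assumes "diagram C G" "last G \<in> tableaux_within l" "R \<in> set G"
  shows "R \<in> tableaux_within l"
proof -
  have "tableau (map last G)" using diagram_border_tableau[OF assms(1)] by simp
  then have "map last G \<in> tableaux_within l"
    using assms by (simp add: tableaux_within_def last_map diagram_def)
  then have "last R 0 \<le> l" using assms(3) by (simp add: tableaux_within_iff)
  then show ?thesis using assms by (auto simp: tableaux_within_def diagram_def)
qed

lemma diagram_border_within:
  assumes "diagram C G" "last G \<in> tableaux_within l" "e = hd \<or> e = last"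
  shows "map e G \<in> tableaux_within l"
proof -
  have "last G \<noteq> []" "G \<noteq> []" using assms by (auto simp: tableaux_within_iff diagram_def)
  then have "e (last G) 0 \<le> l" using assms by (auto simp: tableaux_within_iff)
  then show ?thesis
    using diagram_border_tableau[OF assms(1,3)] \<open>G \<noteq> []\<close> by (simp add: tableaux_within_def last_map)
qed

section \<open>Transport of a row along a column\<close>

text \<open>A move without the fourth side of its array. The column \<open>Q\<close> stands on the
  right for \<open>e = last\<close> and on the left for \<open>e = hd\<close>; backward moves are
  obtained by exchanging \<open>P\<close> with \<open>T\<close> and taking the other column.\<close>

definition transports ::
  "nat \<Rightarrow> (part \<Rightarrow> part \<Rightarrow> part \<Rightarrow> part \<Rightarrow> bool) \<Rightarrow> (tab \<Rightarrow> part) \<Rightarrow> tab \<Rightarrow> tab \<Rightarrow> tab \<Rightarrow> bool" where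
  "transports l C e P Q T \<longleftrightarrow> {P, Q, T} \<subseteq> tableaux_within l \<and>
     (\<exists>G. diagram C G \<and> shift_eq l P (hd G) \<and> shift_eq l Q (map e G) \<and> shift_eq l T (last G))"

text \<open>The diagram is cut at the row that meets the column in the place of
  \<open>\<beta>\<close>; this row belongs to both parts and serves as \<open>S\<close>.\<close>

lemma transports_split:
  assumes "transports l C e P (x @ \<beta> # y) T"
  obtains S where "transports l C e P (x @ [\<beta>]) S" "transports l C e S (\<beta> # y) T"
proof -
  obtain G where G: "diagram C G" "shift_eq l P (hd G)" "shift_eq l (x @ \<beta> # y) (map e G)" "shift_eq l T (last G)"
    and w: "P \<in> tableaux_within l" "x @ \<beta> # y \<in> tableaux_within l" "T \<in> tableaux_within l"
    using assms unfolding transports_def by blast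
  have "length x < length G" using shift_eq_length[OF G(3)] by simp
  then obtain H R K where GH: "G = H @ R # K" "length H = length x"
    by (metis id_take_nth_drop length_take min.absorb4)
  have "last G \<in> tableaux_within l" using shift_eq_within[OF G(4)] w by simp
  then have R: "R \<in> tableaux_within l" using diagram_within[OF G(1)] GH by simp
  have sh: "shift_eq l (x @ \<beta> # y) (map e H @ e R # map e K)" using G(3) GH by simp
  have "shift_eq l (x @ [\<beta>]) (map e H @ [e R])"
    using shift_eq_appendD(1)[of l "x @ [\<beta>]" y "map e H @ [e R]" "map e K"] sh GH by simp
  moreover have "shift_eq l (\<beta> # y) (e R # map e K)"
    using shift_eq_appendD(2)[OF sh] GH by simp
  moreover have "hd (H @ [R]) = hd G" "last (R # K) = last G" using GH by (cases H; simp)+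
  moreover have "diagram C (H @ [R])" "diagram C (R # K)" using G(1) GH diagram_append by blast+
  ultimately have "transports l C e P (x @ [\<beta>]) R" "transports l C e R (\<beta> # y) T"
    unfolding transports_def using G w R within_append[of x \<beta> y l]
    by (intro conjI exI[of _ "H @ [R]"] exI[of _ "R # K"]; simp)+
  then show ?thesis using that by blast
qed

lemma transports_repeat:
  assumes refl: "\<And>a b. \<lbrakk>is_partition a; is_partition b; hstrip a b\<rbrakk> \<Longrightarrow> C a b a b"
    and e: "e = hd \<or> e = last"
  shows "transports l C e P (x @ \<beta> # \<beta> # y) T \<longleftrightarrow> transports l C e P (x @ \<beta> # y) T"
proof
  assume "transports l C e P (x @ \<beta> # \<beta> # y) T"
  then obtain G where G: "diagram C G" "shift_eq l P (hd G)"
      "shift_eq l (x @ \<beta> # \<beta> # y) (map e G)" "shift_eq l T (last G)"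
    and w: "P \<in> tableaux_within l" "x @ \<beta> # \<beta> # y \<in> tableaux_within l" "T \<in> tableaux_within l"
    unfolding transports_def by blast
  have "length x < length G" using shift_eq_length[OF G(3)] by simp
  then obtain H R K' where GH: "G = H @ R # K'" "length H = length x"
    by (metis id_take_nth_drop length_take min.absorb4)
  then obtain R' K where K': "K' = R' # K"
    using shift_eq_length[OF G(3)] by (cases K') auto
  have sh: "shift_eq l (x @ \<beta> # \<beta> # y) (map e H @ e R # e R' # map e K)"
    using G(3) GH K' by simp
  have eq: "e R = e R'" and sh': "shift_eq l (x @ \<beta> # y) (map e H @ e R # map e K)"
    using shift_eq_repeatD[OF sh] GH by auto
  obtain j where j: "j < length (hd G)" "\<And>R. R \<in> set G \<Longrightarrow> e R = R ! j"
    using diagram_border[OF G(1) e] by blast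
  have "step C R R'" using G(1) GH K' by (auto simp: diagram_def successively_append_iff)
  then have "R = R'"
    using step_repeated_column[of C R R' j] G(1) GH K' eq j diagram_length[OF G(1), of R]
    by (auto simp: diagram_def)
  then have "diagram C (H @ R # K)"
    using G(1) GH K' by (auto simp: diagram_def successively_append_iff)
  moreover have "hd (H @ R # K) = hd G" "last (H @ R # K) = last G"
    using GH K' \<open>R = R'\<close> by (cases H; simp)+
  ultimately show "transports l C e P (x @ \<beta> # y) T"
    unfolding transports_def using G w sh' within_repeat[of x \<beta> y l]
    by (auto intro!: exI[of _ "H @ R # K"])
next
  assume "transports l C e P (x @ \<beta> # y) T"
  then obtain G where G: "diagram C G" "shift_eq l P (hd G)"
      "shift_eq l (x @ \<beta> # y) (map e G)" "shift_eq l T (last G)"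
    and w: "P \<in> tableaux_within l" "x @ \<beta> # y \<in> tableaux_within l" "T \<in> tableaux_within l"
    unfolding transports_def by blast
  have "length x < length G" using shift_eq_length[OF G(3)] by simp
  then obtain H R K where GH: "G = H @ R # K" "length H = length x"
    by (metis id_take_nth_drop length_take min.absorb4)
  have sh: "shift_eq l (x @ \<beta> # y) (map e H @ e R # map e K)"
    using G(3) GH by simp
  have "step C R R" using step_refl[of C R] refl G(1) GH by (simp add: diagram_def)
  then have "diagram C (H @ R # R # K)"
    using G(1) GH by (auto simp: diagram_def successively_append_iff)
  moreover have "hd (H @ R # R # K) = hd G" "last (H @ R # R # K) = last G"
    using GH by (cases H; simp)+
  moreover have "shift_eq l (x @ \<beta> # \<beta> # y) (map e (H @ R # R # K))"
    using shift_eq_repeatI[OF sh] GH by simp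
  ultimately show "transports l C e P (x @ \<beta> # \<beta> # y) T"
    unfolding transports_def using G w within_repeat[of x \<beta> y l]
    by (auto intro!: exI[of _ "H @ R # R # K"])
qed

lemma transports_replicate:
  assumes "\<And>a b. \<lbrakk>is_partition a; is_partition b; hstrip a b\<rbrakk> \<Longrightarrow> C a b a b"
    and "e = hd \<or> e = last"
  shows "transports l C e P (x @ replicate (Suc n) \<beta> @ y) T \<longleftrightarrow> transports l C e P (x @ \<beta> # y) T"
proof (induction n)
  case (Suc n)
  then show ?case using transports_repeat[of C e l P x \<beta> "replicate n \<beta> @ y" T, OF assms] by simp
qed simp

text \<open>An insertion rule commutes with prepending \<open>l\<close> only where the result has at
  most \<open>l\<close> columns, whence the bound on \<open>d\<close>. It is supplied by
  \<open>last G\<close>, which bounds all rows.\<close>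

lemma diagram_vshift:
  assumes compat: "\<And>a b c d. \<lbrakk>is_partition a; is_partition b; is_partition c; hstrip a b; hstrip a c;
      d 0 \<le> l; C a b c d\<rbrakk> \<Longrightarrow> C (case_nat l a) (case_nat l b) (case_nat l c) (case_nat l d)"
    and G: "diagram C G" "last G \<in> tableaux_within l"
  shows "diagram C (map (vshift l i) G)"
proof (induction i)
  case 0
  have "map (vshift l 0) G = G" by (rule map_idI) simp
  then show ?case using G by simp
next
  case (Suc i)
  let ?G = "map (vshift l i) G"
  have w: "R \<in> tableaux_within l" if "R \<in> set ?G" for R
    using that diagram_within[OF G] by (auto simp: vshift_within)
  have "step C (map (case_nat l) R) (map (case_nat l) R')"
    if "R \<in> set ?G" "R' \<in> set ?G" "step C R R'" for R R'
  proof -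
    have len: "length R' = length R" using that(3) by (simp add: step_def)
    have "is_partition (R ! j)" "is_partition (R' ! j)" "(R' ! j) 0 \<le> l" if "j < length R" for j
      using w[OF \<open>R \<in> set ?G\<close>] w[OF \<open>R' \<in> set ?G\<close>] that len by (auto simp: tableaux_within_iff)
    moreover have "hstrip (R ! j) (R ! Suc j)" if "Suc j < length R" for j
      using w[OF \<open>R \<in> set ?G\<close>] that by (auto simp: tableaux_within_iff successively_conv_nth)
    ultimately show ?thesis
      using that(3) len compat unfolding step_def
      by (auto simp: hstrip_case_nat psize_case_nat)
  qed
  then have "successively (step C) (map (map (case_nat l)) ?G)"
    using Suc unfolding diagram_def successively_map[of _ "map (case_nat l)"]
    by (auto elim: successively_mono)
  moreover have "tableau (map (case_nat l) R)" if "R \<in> set ?G" for R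
    using w[OF that] vshift_within[of l 1 R] by (simp add: vshift_one tableaux_within_def)
  ultimately have "diagram C (map (map (case_nat l)) ?G)"
    using G unfolding diagram_def by auto
  moreover have "map (vshift l (Suc i)) G = map (map (case_nat l)) ?G"
    by (simp add: vshift_Suc[of l i] vshift_one)
  ultimately show ?case by metis
qed

text \<open>Both diagrams contain \<open>S\<close> only up to shift. Each is shifted as a whole
  until the last row of the first is the first row of the second; stability of \<open>C\<close>
  under prepending keeps them diagrams.\<close>

lemma transports_glue:
  assumes compat: "\<And>a b c d. \<lbrakk>is_partition a; is_partition b; is_partition c; hstrip a b; hstrip a c;
      d 0 \<le> l; C a b c d\<rbrakk> \<Longrightarrow> C (case_nat l a) (case_nat l b) (case_nat l c) (case_nat l d)"
    and e: "e = hd \<or> e = last"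
    and 1: "transports l C e P (x @ [\<beta>]) S" and 2: "transports l C e S (\<beta> # y) T"
  shows "transports l C e P (x @ \<beta> # y) T"
proof -
  obtain G where G: "diagram C G" "shift_eq l P (hd G)" "shift_eq l (x @ [\<beta>]) (map e G)" "shift_eq l S (last G)"
    and wG: "P \<in> tableaux_within l" "x @ [\<beta>] \<in> tableaux_within l" "S \<in> tableaux_within l"
    using 1 unfolding transports_def by blast
  obtain H where H: "diagram C H" "shift_eq l S (hd H)" "shift_eq l (\<beta> # y) (map e H)" "shift_eq l T (last H)"
    and wH: "\<beta> # y \<in> tableaux_within l" "T \<in> tableaux_within l"
    using 2 unfolding transports_def by blast
  obtain i j where ij: "vshift l i (last G) = vshift l j (hd H)"
    using G(4) H(2) shift_eq_sym shift_eq_trans unfolding shift_eq_def by meson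
  have ne: "G \<noteq> []" "H \<noteq> []" using G H by (auto simp: diagram_def)
  let ?G = "map (vshift l i) G" and ?H = "map (vshift l j) H"
  \<comment> \<open>The common row along which the shifted diagrams are joined.\<close>
  define R where "R = vshift l i (last G)"
  obtain G' where G': "?G = G' @ [R]"
    using ne by (metis R_def append_butlast_last_id last_map map_is_Nil_conv)
  obtain H' where H': "?H = R # H'"
    using ne ij by (metis R_def hd_Cons_tl hd_map map_is_Nil_conv)
  have "diagram C ?G"
    using diagram_vshift[OF compat G(1)] shift_eq_within[OF G(4)] wG by blast
  moreover have "diagram C ?H"
    using diagram_vshift[OF compat H(1)] shift_eq_within[OF H(4)] wH by blast
  ultimately have D: "diagram C (G' @ R # H')"
    using G' H' by (subst diagram_append) simp
  have ev: "map e (map (vshift l m) K) = vshift l m (map e K)" if "diagram C K" for m K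
    using that e unfolding vshift_def[of l m "map e K"]
    by (auto simp: diagram_def tableau_def hd_vshift last_vshift)
  have "shift_eq l (x @ [\<beta>]) (map e ?G)"
    unfolding ev[OF G(1)] using shift_eq_trans[OF G(3) shift_eq_vshift] .
  then have s1: "shift_eq l (x @ [\<beta>]) (map e G' @ [e R])" using G' by simp
  have "shift_eq l (\<beta> # y) (map e ?H)"
    unfolding ev[OF H(1)] using shift_eq_trans[OF H(3) shift_eq_vshift] .
  then have s2: "shift_eq l (\<beta> # y) (e R # map e H')" using H' by simp
  \<comment> \<open>The two columns overlap in \<open>e R\<close>, which stands for
    \<open>\<beta>\<close>; this reconciles their independent shifts.\<close>
  have "shift_eq l (x @ \<beta> # y) (map e (G' @ R # H'))"
    using shift_eq_join[OF s1 s2] wG wH by simp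
  moreover have "hd (G' @ R # H') = vshift l i (hd G)"
    using G' ne by (metis hd_append2 hd_map list.sel(1) append_Nil)
  moreover have "last (G' @ R # H') = vshift l j (last H)"
    using H' ne by (metis last_appendR last_map list.distinct(1))
  ultimately show ?thesis
    unfolding transports_def using D wG wH G H within_append[of x \<beta> y l]
    by (auto intro!: exI[of _ "G' @ R # H'"] intro: shift_eq_trans[OF _ shift_eq_vshift])
qed

text \<open>A pair of consecutive partitions is padded by repeating its outer member. The final
  constant piece keeps the list nonempty for a tableau with one partition, where a move only tests a
  border.\<close>

fun pieces :: "nat \<Rightarrow> tab \<Rightarrow> tab list" where
  "pieces k [] = []"
| "pieces k [\<beta>] = [replicate (Suc k) \<beta>]"
| "pieces k (\<beta> # \<gamma> # Q) = (\<beta> # replicate k \<gamma>) # pieces k (\<gamma> # Q)"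

fun chained :: "(tab \<Rightarrow> tab \<Rightarrow> tab \<Rightarrow> bool) \<Rightarrow> tab list \<Rightarrow> tab \<Rightarrow> tab \<Rightarrow> bool" where
  "chained V [] P T \<longleftrightarrow> T = P"
| "chained V (Q # Qs) P T \<longleftrightarrow> (\<exists>S. V P Q S \<and> chained V Qs S T)"

lemma pieces_subset:
  assumes "Q \<in> tableaux_within l" "0 < k"
  shows "set (pieces k Q) \<subseteq> tableaux_kl k l"
  using assms
proof (induction k Q rule: pieces.induct)
  case (2 k \<beta>)
  have "replicate (Suc n) \<beta> \<in> tableaux_within l" for n
    using 2 by (induction n) (auto simp: within_repeat[of "[]", simplified])
  then show ?case by (simp add: tableaux_kl_def)
next
  case (3 k \<beta> \<gamma> Q)
  have w: "[\<beta>, \<gamma>] \<in> tableaux_within l" "\<gamma> # Q \<in> tableaux_within l"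
    using 3(2) within_append[of "[\<beta>]" \<gamma> Q] by auto
  have "\<beta> # replicate (Suc n) \<gamma> \<in> tableaux_within l" for n
    using w(1) by (induction n) (auto simp: within_repeat[of "[\<beta>]", simplified])
  then have "\<beta> # replicate k \<gamma> \<in> tableaux_kl k l"
    using 3(3) by (cases k) (simp_all add: tableaux_kl_def)
  then show ?case using 3 w by simp
qed simp

text \<open>The column is cut after its first pair, and the pair is padded by repetition, which does
  not affect the transport.\<close>

lemma pieces_transports:
  assumes refl: "\<And>a b. \<lbrakk>is_partition a; is_partition b; hstrip a b\<rbrakk> \<Longrightarrow> C a b a b"
    and e: "e = hd \<or> e = last" and "0 < k"
    and "transports l C e P Q T"
  shows "chained (transports l C e) (pieces k Q) P T"
  using assms(3,4)
proof (induction k Q arbitrary: P rule: pieces.induct)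
  case (1 k)
  then show ?case by (simp add: transports_def tableaux_within_iff)
next
  case (2 k \<beta>)
  then show ?case using transports_replicate[of C e l P "[]" k \<beta> "[]", OF refl e] by auto
next
  case (3 k \<beta> \<gamma> Q)
  obtain S where S: "transports l C e P [\<beta>, \<gamma>] S" "transports l C e S (\<gamma> # Q) T"
    using transports_split[of l C e P "[\<beta>]" \<gamma> Q T] 3(3) by auto
  obtain n where n: "k = Suc n" using 3(2) by (cases k) auto
  have "transports l C e P (\<beta> # replicate k \<gamma>) S"
    using S(1) transports_replicate[of C e l P "[\<beta>]" n \<gamma> "[]", OF refl e] n by simp
  then show ?case using 3(1)[OF 3(2) S(2)] by auto
qed

text \<open>The converse has to reassemble the arrays of the pieces, so it goes through
  \<open>transports_glue\<close> and asks for compatibility with prepending.\<close>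

lemma transports_pieces:
  assumes refl: "\<And>a b. \<lbrakk>is_partition a; is_partition b; hstrip a b\<rbrakk> \<Longrightarrow> C a b a b"
    and compat: "\<And>a b c d. \<lbrakk>is_partition a; is_partition b; is_partition c; hstrip a b; hstrip a c;
      d 0 \<le> l; C a b c d\<rbrakk> \<Longrightarrow> C (case_nat l a) (case_nat l b) (case_nat l c) (case_nat l d)"
    and e: "e = hd \<or> e = last" and "0 < k" "Q \<noteq> []"
    and "chained (transports l C e) (pieces k Q) P T"
  shows "transports l C e P Q T"
  using assms(4-)
proof (induction k Q arbitrary: P rule: pieces.induct)
  case (2 k \<beta>)
  then show ?case using transports_replicate[of C e l P "[]" k \<beta> "[]", OF refl e] by auto
next
  case (3 k \<beta> \<gamma> Q)
  obtain S where S: "transports l C e P (\<beta> # replicate k \<gamma>) S" "transports l C e S (\<gamma> # Q) T"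
    using 3 by auto
  obtain n where n: "k = Suc n" using 3(2) by (cases k) auto
  have "transports l C e P [\<beta>, \<gamma>] S"
    using S(1) transports_replicate[of C e l P "[\<beta>]" n \<gamma> "[]", OF refl e] n by simp
  then show ?case using transports_glue[of l C e P "[\<beta>]" \<gamma> S Q T, OF compat e] S(2) by simp
qed simp

text \<open>Necessary conditions in which only end partitions occur. For switching they are also
  sufficient, so that existence of a move depends on the shape alone.\<close>

lemma transports_borders:
  assumes "transports l C e P Q T" "e = hd \<or> e = last"
  shows "\<exists>i j. prepend l i (e P) = prepend l j (hd Q)"
    and "\<exists>i j. prepend l i (e T) = prepend l j (last Q)"
proof -
  obtain G where G: "diagram C G" "shift_eq l P (hd G)" "shift_eq l Q (map e G)" "shift_eq l T (last G)"
    and w: "P \<in> tableaux_within l" "Q \<in> tableaux_within l" "T \<in> tableaux_within l"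
    using assms(1) unfolding transports_def by blast
  have wne: "P \<noteq> []" "Q \<noteq> []" "T \<noteq> []" using w by (auto simp: tableaux_within_iff)
  have ne: "G \<noteq> []" "hd G \<noteq> []" "last G \<noteq> []" using G(1) by (auto simp: diagram_def tableau_def)
  have e: "\<exists>i j. prepend l i (f S) = prepend l j (f S')"
    if "shift_eq l S S'" "S \<noteq> []" "S' \<noteq> []" "f = hd \<or> f = last" for S S' and f :: "tab \<Rightarrow> part"
    using that unfolding shift_eq_def by (metis hd_vshift last_vshift)
  have trans: "\<exists>i j. prepend l i a = prepend l j c"
    if ab: "\<exists>i j. prepend l i a = prepend l j b" and cb: "\<exists>i j. prepend l i c = prepend l j b" for a b c
  proof -
    obtain i j m n where "prepend l i a = prepend l j b" "prepend l m c = prepend l n b"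
      using ab cb by blast
    then have "prepend l (n + i) a = prepend l (j + m) c"
      by (metis prepend_prepend add.commute)
    then show ?thesis by blast
  qed
  have "\<exists>i j. prepend l i (hd Q) = prepend l j (e (hd G))"
    using e[OF G(3) wne(2), of hd] ne by (simp add: hd_map)
  then show "\<exists>i j. prepend l i (e P) = prepend l j (hd Q)"
    by (rule trans[rotated]) (use e[OF G(2) _ ne(2) assms(2)] wne in blast)
  have "\<exists>i j. prepend l i (last Q) = prepend l j (e (last G))"
    using e[OF G(3) wne(2), of last] ne by (simp add: last_map)
  then show "\<exists>i j. prepend l i (e T) = prepend l j (last Q)"
    by (rule trans[rotated]) (use e[OF G(4) _ ne(3) assms(2)] wne in blast)
qed

section \<open>Switching rules\<close>

abbreviation switching_cell :: "rule \<Rightarrow> part \<Rightarrow> part \<Rightarrow> part \<Rightarrow> part \<Rightarrow> bool" where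
  "switching_cell L \<equiv> \<lambda>\<alpha> \<beta> \<gamma> \<delta>. \<gamma> = L \<alpha> \<beta> \<delta>"

context
  fixes L :: rule
  assumes L: "switching_rule L"
begin

lemma switching_rule_growth:
  assumes "is_partition \<alpha>" "is_partition \<beta>" "is_partition \<delta>" "hstrip \<alpha> \<beta>" "hstrip \<beta> \<delta>"
  shows "growth_diagram [[\<alpha>, \<beta>], [L \<alpha> \<beta> \<delta>, \<delta>]]"
  using L assms unfolding switching_rule_def by blast

text \<open>When \<open>b\<close> is repeated in the right column of a cell, the left column has
  content zero as well.\<close>

lemma switching_cell_refl:
  assumes "is_partition a" "is_partition b" "hstrip a b"
  shows "switching_cell L a b a b"
proof (rule hstrip_psize_eq)
  have "growth_diagram [[a, b], [L a b b, b]]"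
    using assms by (intro switching_rule_growth) (auto simp: hstrip_refl)
  then show "is_partition a" "is_partition (L a b b)" "hstrip a (L a b b)" "psize (L a b b) - psize a = 0"
    by (auto simp: growth_diagram_cell)
qed

text \<open>The row is filled from right to left, as a cell yields its lower left corner from the
  other three.\<close>

lemma switching_step_down:
  assumes "tableau P" "is_partition \<delta>" "hstrip (last P) \<delta>"
  shows "\<exists>R. tableau R \<and> step (switching_cell L) P R \<and> last R = \<delta>"
  using assms
proof (induction P rule: induct_list012)
  case (2 \<alpha>)
  then show ?case by (intro exI[of _ "[\<delta>]"]) (simp add: tableau_def step_single)
next
  case (3 \<alpha> \<beta> P)
  have t: "is_partition \<alpha>" "is_partition \<beta>" "hstrip \<alpha> \<beta>" "tableau (\<beta> # P)"
    using 3(3) by (auto simp: tableau_def)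
  obtain R where R: "tableau R" "step (switching_cell L) (\<beta> # P) R" "last R = \<delta>"
    using 3(2)[OF t(4) 3(4)] 3(5) by auto
  then obtain \<delta>' R' where R': "R = \<delta>' # R'" by (cases R) (auto simp: tableau_def)
  have "hstrip \<beta> \<delta>'" using R(2) R' by (auto simp: step_def)
  then have "growth_diagram [[\<alpha>, \<beta>], [L \<alpha> \<beta> \<delta>', \<delta>']]"
    using t R R' by (intro switching_rule_growth) (auto simp: tableau_def)
  then have "tableau (L \<alpha> \<beta> \<delta>' # R)" "step (switching_cell L) (\<alpha> # \<beta> # P) (L \<alpha> \<beta> \<delta>' # R)"
    using R R' by (auto simp: growth_diagram_cell step_Cons tableau_def)
  then show ?case using R R' by (intro exI[of _ "L \<alpha> \<beta> \<delta>' # R"]) simp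
qed (simp add: tableau_def)

lemma switching_step_up:
  assumes "tableau P" "is_partition \<alpha>" "hstrip \<alpha> (hd P)"
  shows "\<exists>R. tableau R \<and> step (switching_cell L) R P \<and> hd R = \<alpha>"
  using assms
proof (induction P arbitrary: \<alpha> rule: induct_list012)
  case (2 \<gamma>)
  then show ?case by (intro exI[of _ "[\<alpha>]"]) (simp add: tableau_def step_single)
next
  case (3 \<gamma> \<delta> P)
  have t: "is_partition \<gamma>" "is_partition \<delta>" "hstrip \<gamma> \<delta>" "tableau (\<delta> # P)"
    using 3(3) by (auto simp: tableau_def)
  \<comment> \<open>The involutive clause of the rule turns cells around: with
    \<open>L \<alpha> \<gamma> \<delta>\<close> as upper right corner, \<open>\<gamma>\<close> is
    the value that the rule prescribes at the lower left. So a row is filled upwards from left to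
    right.\<close>
  define \<beta> where "\<beta> = L \<alpha> \<gamma> \<delta>"
  have g: "growth_diagram [[\<alpha>, \<gamma>], [\<beta>, \<delta>]]"
    unfolding \<beta>_def using t 3 by (intro switching_rule_growth) auto
  then have \<gamma>: "\<gamma> = L \<alpha> \<beta> \<delta>"
    using L \<beta>_def unfolding switching_rule_def growth_diagram_cell by blast
  obtain R where R: "tableau R" "step (switching_cell L) R (\<delta> # P)" "hd R = \<beta>"
    using 3(2)[OF t(4), of \<beta>] g by (auto simp: growth_diagram_cell)
  then obtain R' where R': "R = \<beta> # R'" by (cases R) (auto simp: tableau_def)
  have "tableau (\<alpha> # R)" "step (switching_cell L) (\<alpha> # R) (\<gamma> # \<delta> # P)"
    using R R' g \<gamma> by (auto simp: growth_diagram_cell step_Cons tableau_def)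
  then show ?case by (intro exI[of _ "\<alpha> # R"]) simp
qed (simp add: tableau_def)

lemma switching_diagram_down:
  assumes "tableau P" "tableau Q" "last P = hd Q"
  shows "\<exists>G. diagram (switching_cell L) G \<and> hd G = P \<and> map last G = Q"
  using assms
proof (induction Q arbitrary: P rule: induct_list012)
  case (2 \<delta>)
  then show ?case by (intro exI[of _ "[P]"]) (simp add: diagram_def)
next
  case (3 \<beta> \<delta> Q)
  have "is_partition \<delta>" "hstrip (last P) \<delta>" using 3(4,5) by (simp_all add: tableau_def)
  then obtain R where R: "tableau R" "step (switching_cell L) P R" "last R = \<delta>"
    using switching_step_down[OF 3(3)] by blast
  have "tableau (\<delta> # Q)" "last R = hd (\<delta> # Q)" using 3(4) R(3) by (simp_all add: tableau_def)
  from 3(2)[OF R(1) this]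
  obtain G where G: "diagram (switching_cell L) G" "hd G = R" "map last G = \<delta> # Q"
    by (elim exE conjE)
  have "diagram (switching_cell L) (P # G)"
    using G(1,2) R(2) 3(3) by (cases G) (simp_all add: diagram_def)
  moreover have "map last (P # G) = \<beta> # \<delta> # Q" using G(3) 3(5) by simp
  ultimately show ?case by (intro exI[of _ "P # G"]) simp
qed (simp add: tableau_def)

lemma switching_diagram_up:
  assumes "tableau P" "tableau Q" "last Q = hd P"
  shows "\<exists>G. diagram (switching_cell L) G \<and> last G = P \<and> map hd G = Q"
  using assms
proof (induction Q arbitrary: P rule: rev_induct)
  case (snoc \<gamma> Q)
  show ?case
  proof (cases "Q = []")
    case True
    then show ?thesis using snoc by (intro exI[of _ "[P]"]) (simp add: diagram_def)
  next
    case False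
    then have t: "tableau Q" "is_partition (last Q)" "hstrip (last Q) \<gamma>"
      using snoc(3) by (auto simp: tableau_def successively_append_iff)
    obtain R where R: "tableau R" "step (switching_cell L) R P" "hd R = last Q"
      using switching_step_up[of P "last Q"] t snoc by auto
    obtain G where G: "diagram (switching_cell L) G" "last G = R" "map hd G = Q"
      using snoc(1)[of R] R t by auto
    then show ?thesis
      using R snoc by (intro exI[of _ "G @ [P]"]) (auto simp: diagram_def successively_append_iff)
  qed
qed (simp add: tableau_def)

text \<open>Only the outer border of \<open>P\<close> and its column bound enter. \<open>P\<close>
  and \<open>Q\<close> are shifted separately until their borders agree, and the array is completed
  afterwards.\<close>

lemma switching_transports_down:
  assumes "P \<in> tableaux_within l" "Q \<in> tableaux_within l"
    and "prepend l i (last P) = prepend l j (hd Q)"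
  shows "\<exists>T. transports l (switching_cell L) last P Q T"
proof -
  have w: "vshift l i P \<in> tableaux_within l" "vshift l j Q \<in> tableaux_within l"
    using assms by (simp_all add: vshift_within)
  moreover have "last (vshift l i P) = hd (vshift l j Q)"
    using assms by (simp add: last_vshift hd_vshift tableaux_within_iff)
  ultimately obtain G where G: "diagram (switching_cell L) G" "hd G = vshift l i P" "map last G = vshift l j Q"
    using switching_diagram_down unfolding tableaux_within_def by blast
  have "G \<noteq> []" using G by (simp add: diagram_def)
  then have "last (last G) 0 \<le> l"
    using w(2) unfolding tableaux_within_def G(3)[symmetric] by (simp add: last_map)
  then have "last G \<in> tableaux_within l"
    using G(1) by (simp add: tableaux_within_def diagram_def)
  then show ?thesis
    unfolding transports_def using G assms by (intro exI[of _ "last G"]) auto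
qed

lemma switching_transports_up:
  assumes "P \<in> tableaux_within l" "Q \<in> tableaux_within l"
    and "prepend l i (hd P) = prepend l j (last Q)"
  shows "\<exists>T. transports l (switching_cell L) hd T Q P"
proof -
  have w: "vshift l i P \<in> tableaux_within l" "vshift l j Q \<in> tableaux_within l"
    using assms by (simp_all add: vshift_within)
  moreover have "last (vshift l j Q) = hd (vshift l i P)"
    using assms by (simp add: last_vshift hd_vshift tableaux_within_iff)
  ultimately obtain G where G: "diagram (switching_cell L) G" "last G = vshift l i P" "map hd G = vshift l j Q"
    using switching_diagram_up unfolding tableaux_within_def by blast
  have "hd G \<in> tableaux_within l"
    using diagram_within[OF G(1)] G w by (simp add: diagram_def)
  then show ?thesis
    unfolding transports_def using G assms by (intro exI[of _ "hd G"]) auto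
qed

end

section \<open>Insertion rules\<close>

abbreviation insertion_cell :: "rule \<Rightarrow> part \<Rightarrow> part \<Rightarrow> part \<Rightarrow> part \<Rightarrow> bool" where
  "insertion_cell L \<equiv> \<lambda>\<alpha> \<beta> \<gamma> \<delta>. \<delta> = L \<alpha> \<beta> \<gamma>"

lemma insertion_cell_refl:
  assumes "insertion_rule L" "is_partition a" "is_partition b" "hstrip a b"
  shows "insertion_cell L a b a b"
proof (rule hstrip_psize_eq)
  have "growth_diagram [[a, b], [a, L a b a]]"
    using assms hstrip_refl unfolding insertion_rule_def by blast
  then show "is_partition b" "is_partition (L a b a)" "hstrip b (L a b a)" "psize (L a b a) - psize b = 0"
    by (auto simp: growth_diagram_cell)
qed

lemma insertion_cell_case_nat:
  assumes "insertion_rule L" "is_partition a" "is_partition b" "is_partition c" "hstrip a b" "hstrip a c"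
    and "d 0 \<le> l" "insertion_cell L a b c d"
  shows "insertion_cell L (case_nat l a) (case_nat l b) (case_nat l c) (case_nat l d)"
  using assms unfolding insertion_rule_def by metis

section \<open>Tableaux operations\<close>

text \<open>\<open>Q\<close> is written on the side \<open>e\<close> and \<open>U\<close> is read
  off on the side \<open>e'\<close>: \<open>last\<close> and \<open>hd\<close> for switching,
  \<open>hd\<close> and \<open>last\<close> for insertion.\<close>

definition array ::
  "(part \<Rightarrow> part \<Rightarrow> part \<Rightarrow> part \<Rightarrow> bool) \<Rightarrow> (tab \<Rightarrow> part) \<Rightarrow> (tab \<Rightarrow> part) \<Rightarrow>
     tab \<Rightarrow> tab \<Rightarrow> tab \<Rightarrow> tab \<Rightarrow> bool" where
  "array C e e' P Q T U \<longleftrightarrow>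
     (\<exists>G. diagram C G \<and> hd G = P \<and> map e G = Q \<and> last G = T \<and> map e' G = U)"

lemma switching_array_eq: "switching_array L = array (switching_cell L) last hd"
  by (simp add: fun_eq_iff switching_array_def array_def diagram_iff conj_assoc)

lemma insertion_array_eq: "insertion_array L = array (insertion_cell L) hd last"
  by (simp add: fun_eq_iff insertion_array_def array_def diagram_iff conj_assoc)

text \<open>The side \<open>U\<close> can always be read off from the diagram and obeys the column
  bound, so a move loses nothing when \<open>U\<close> is forgotten.\<close>

lemma up_to_shift_transports:
  assumes "e' = hd \<or> e' = last"
  shows "(\<exists>U. up_to_shift l (array C e e') P Q T U) \<longleftrightarrow> transports l C e P Q T"
proof
  assume "\<exists>U. up_to_shift l (array C e e') P Q T U"
  then show "transports l C e P Q T"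
    unfolding up_to_shift_def array_def transports_def by blast
next
  assume "transports l C e P Q T"
  then obtain G where G: "diagram C G" "shift_eq l P (hd G)" "shift_eq l Q (map e G)" "shift_eq l T (last G)"
    and w: "P \<in> tableaux_within l" "Q \<in> tableaux_within l" "T \<in> tableaux_within l"
    unfolding transports_def by blast
  have "map e' G \<in> tableaux_within l"
    using diagram_border_within[OF G(1) _ assms] shift_eq_within[OF G(4)] w by blast
  then have "up_to_shift l (array C e e') P Q T (map e' G)"
    unfolding up_to_shift_def array_def using G w shift_eq_refl by blast
  then show "\<exists>U. up_to_shift l (array C e e') P Q T U" by blast
qed

text \<open>The same arrays with the two columns exchanged. This turns a backward move from
  \<open>P\<close> to \<open>T\<close> into a transport from \<open>T\<close> to \<open>P\<close>
  along the opposite column.\<close>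

lemma up_to_shift_swap:
  "up_to_shift l (array C e e') P U T Q \<longleftrightarrow> up_to_shift l (array C e' e) P Q T U"
  unfolding up_to_shift_def array_def by blast

lemma up_to_shift_length:
  assumes "up_to_shift l (array C e e') P Q T U"
  shows "length T = length P" "length U = length Q"
proof -
  obtain G where G: "diagram C G" "shift_eq l P (hd G)" "shift_eq l Q (map e G)"
      "shift_eq l T (last G)" "shift_eq l U (map e' G)"
    using assms unfolding up_to_shift_def array_def by blast
  have "last G \<in> set G" using G(1) by (simp add: diagram_def)
  then show "length T = length P" "length U = length Q"
    using diagram_length[OF G(1)] G(2-)[THEN shift_eq_length] by simp_all
qed

lemma up_to_shift_cong:
  assumes "up_to_shift l A P Q T U"
    and "shift_eq l P P'" "shift_eq l Q Q'" "shift_eq l T T'" "shift_eq l U U'"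
  shows "up_to_shift l A P' Q' T' U'"
proof -
  have "{P', Q', T', U'} \<subseteq> tableaux_within l"
    using assms(1) assms(2-)[THEN shift_eq_within] unfolding up_to_shift_def by simp
  then show ?thesis
    using assms shift_eq_trans shift_eq_sym unfolding up_to_shift_def by meson
qed

section \<open>Sequences of moves and their refinement into pieces\<close>

lemma apply_moves_append:
  "apply_moves F (ms @ ms') P T \<longleftrightarrow> (\<exists>S. apply_moves F ms P S \<and> apply_moves F ms' S T)"
  by (induction F ms P T rule: apply_moves.induct) auto

lemma apply_moves_chained:
  "apply_moves F (map (Pair d) Qs) P T \<longleftrightarrow> chained (\<lambda>P Q T. \<exists>U. F d P Q T U) Qs P T"
  by (induction Qs arbitrary: P) auto

lemma chained_snoc:
  "chained V (Qs @ [Q]) P T \<longleftrightarrow> (\<exists>S. chained V Qs P S \<and> V S Q T)"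
  by (induction Qs arbitrary: P) auto

lemma chained_rev: "chained V (rev Qs) P T \<longleftrightarrow> chained (\<lambda>P Q T. V T Q P) Qs T P"
  by (induction Qs arbitrary: T) (auto simp: chained_snoc)

text \<open>A backward move climbs the array from its last row and so meets the pieces in reverse
  order; each piece is still a column read downwards.\<close>

fun piece_moves :: "nat \<Rightarrow> direction \<Rightarrow> tab \<Rightarrow> (direction \<times> tab) list" where
  "piece_moves k Forward Q = map (Pair Forward) (pieces k Q)"
| "piece_moves k Backward Q = map (Pair Backward) (rev (pieces k Q))"

definition refine_moves :: "nat \<Rightarrow> (direction \<times> tab) list \<Rightarrow> (direction \<times> tab) list" where
  "refine_moves k ms = concat (map (\<lambda>(d, Q). piece_moves k d Q) ms)"

text \<open>Only the tableaux that determine the moves have prescribed length; the moved tableaux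
  are arbitrary.\<close>

definition dual_equivalent_kl :: "nat \<Rightarrow> nat \<Rightarrow> operation \<Rightarrow> tab \<Rightarrow> tab \<Rightarrow> bool" where
  "dual_equivalent_kl k l F P P' \<longleftrightarrow> same_shape l P P' \<and>
     (\<forall>ms. snd ` set ms \<subseteq> tableaux_kl k l \<longrightarrow>
        ((\<exists>T. apply_moves F ms P T) \<longleftrightarrow> (\<exists>T'. apply_moves F ms P' T')) \<and>
        (\<forall>T T'. apply_moves F ms P T \<and> apply_moves F ms P' T' \<longrightarrow> same_shape l T T'))"

lemma dual_equivalent_kl_sym: "dual_equivalent_kl k l F P P' \<Longrightarrow> dual_equivalent_kl k l F P' P"
  unfolding dual_equivalent_kl_def by (meson same_shape_sym)

lemma kl_within: "T \<in> tableaux_kl k l \<Longrightarrow> T \<in> tableaux_within l"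
  by (simp add: tableaux_kl_def)

lemma kl_length: "T \<in> tableaux_kl k l \<Longrightarrow> length T = Suc k"
  by (simp add: tableaux_kl_def)

section \<open>Complementation\<close>

lemma complement_nth: "i \<le> k \<Longrightarrow> complement k l T ! i = prepend l i (T ! (k - i))"
  unfolding complement_def by (metis add_0 diff_zero length_upt less_Suc_eq_le nth_map nth_upt)

lemma length_complement [simp]: "length (complement k l T) = Suc k"
  by (simp add: complement_def)

lemma complement_kl:
  assumes T: "T \<in> tableaux_kl k l"
  shows "complement k l T \<in> tableaux_kl k l"
proof -
  have part: "is_partition (prepend l i a) \<and> prepend l i a 0 \<le> l" if "is_partition a" "a 0 \<le> l" for i a
    using that by (induction i) (simp_all add: prepend_Suc is_partition_case_nat)
  have strip: "hstrip (prepend l i a) (prepend l i b)" if "hstrip a b" "b 0 \<le> l" for i a b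
    using that
  proof (induction i)
    case (Suc i)
    have "prepend l i b 0 \<le> l" using Suc(3) by (cases i) (simp_all add: prepend_Suc)
    then show ?case using Suc by (simp add: prepend_Suc hstrip_case_nat)
  qed simp
  have nth: "is_partition (T ! i)" "(T ! i) 0 \<le> l" if "i \<le> k" for i
    using T that kl_length[OF T] by (auto simp: tableaux_kl_def tableaux_within_iff)
  have "hstrip (prepend l i (T ! (k - i))) (prepend l (Suc i) (T ! (k - Suc i)))" if i: "i < k" for i
  proof -
    have "hstrip (T ! (k - Suc i)) (T ! Suc (k - Suc i))"
      using T i unfolding tableaux_kl_def tableaux_within_iff by (auto simp: successively_conv_nth)
    then have "hstrip (T ! (k - Suc i)) (T ! (k - i))"
      using i by (simp add: Suc_diff_Suc)
    \<comment> \<open>Interlacing can be read from the other side: if \<open>b/a\<close> is a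
      horizontal strip and \<open>b 0 \<le> l\<close>, then \<open>(l, a)/b\<close> is one
      too.\<close>
    then have "hstrip (T ! (k - i)) (case_nat l (T ! (k - Suc i)))"
      using nth[of "k - i"] by (auto simp: hstrip_def split: nat.split)
    then show ?thesis
      using strip[of _ "case_nat l (T ! (k - Suc i))" i]
      by (simp add: prepend_def funpow_swap1)
  qed
  then have "successively hstrip (complement k l T)"
    by (simp add: successively_conv_nth complement_nth)
  moreover have "is_partition \<beta> \<and> \<beta> 0 \<le> l" if "\<beta> \<in> set (complement k l T)" for \<beta>
    using that part nth by (auto simp: complement_def)
  moreover have "complement k l T \<noteq> []" by (simp add: complement_def)
  ultimately show ?thesis by (simp add: tableaux_kl_def tableaux_within_iff)
qed

text \<open>The partition at place \<open>i\<close> receives \<open>k - i\<close> rows the first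
  time and \<open>i\<close> rows the second time.\<close>

lemma complement_complement:
  assumes "length T = Suc k"
  shows "complement k l (complement k l T) = vshift l k T"
proof (rule nth_equalityI)
  fix i assume "i < length (complement k l (complement k l T))"
  then have "i \<le> k" by simp
  then show "complement k l (complement k l T) ! i = vshift l k T ! i"
    using assms by (simp add: complement_nth prepend_prepend vshift_def)
qed (simp add: assms)

lemma same_shape_complement:
  assumes "length S = Suc k" "length T = Suc k"
  shows "same_shape l (complement k l S) (complement k l T) \<longleftrightarrow> same_shape l S T"
proof -
  have "hd (complement k l R) = last R \<and> last (complement k l R) = prepend l k (hd R)"
    if "length R = Suc k" for R
  proof -
    have "R \<noteq> []" "complement k l R \<noteq> []" using that by (auto simp: complement_def)
    then show ?thesis
      using that by (simp add: hd_conv_nth last_conv_nth complement_nth)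
  qed
  then have "same_shape l (complement k l S) (complement k l T) \<longleftrightarrow>
      (\<exists>i j. prepend l i (last S) = prepend l j (last T) \<and>
        prepend l (i + k) (hd S) = prepend l (j + k) (hd T))"
    using assms by (simp add: same_shape_def prepend_prepend)
  \<comment> \<open>The \<open>k\<close> additional rows on the inner borders cancel by injectivity
    of prepending.\<close>
  also have "\<dots> \<longleftrightarrow> same_shape l S T"
    unfolding same_shape_def by (auto simp: add.commute[of _ k] prepend_prepend[symmetric])
  finally show ?thesis .
qed

text \<open>
  The disjunction \<open>op_join\<close> carries the existence of moves over to tableaux of the same shape: its first
  half holds for insertion rules, its second half for switching rules.
\<close>

locale tableaux_operation =
  fixes k l :: nat and F :: operation
  assumes k_pos: "0 < k"
    and op_within: "F d P Q T U \<Longrightarrow> {P, Q, T, U} \<subseteq> tableaux_within l"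
    and op_shift: "\<lbrakk>F d P Q T U; shift_eq l P P'; shift_eq l Q Q'; shift_eq l T T'; shift_eq l U U'\<rbrakk>
      \<Longrightarrow> F d P' Q' T' U'"
    and op_length: "F d P Q T U \<Longrightarrow> length T = length P \<and> length U = length Q"
    and op_split: "F d P Q T U \<Longrightarrow> apply_moves F (piece_moves k d Q) P T"
    and op_join:
      "(\<forall>d P Q T. Q \<in> tableaux_within l \<and> apply_moves F (piece_moves k d Q) P T \<longrightarrow> (\<exists>U. F d P Q T U)) \<or>
       (\<forall>d P P' Q T U. F d P Q T U \<and> P' \<in> tableaux_within l \<and> same_shape l P P' \<longrightarrow>
          (\<exists>T' U'. F d P' Q T' U'))"
begin

section \<open>Reduction to moves along tableaux of fixed length\<close>

lemma apply_moves_within: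
  assumes "apply_moves F ms P T"
  shows "snd ` set ms \<subseteq> tableaux_within l" and "P \<in> tableaux_within l \<Longrightarrow> T \<in> tableaux_within l"
proof -
  have "snd ` set ms \<subseteq> tableaux_within l \<and> (P \<in> tableaux_within l \<longrightarrow> T \<in> tableaux_within l)"
    using assms
  proof (induction ms arbitrary: P)
    case (Cons m ms)
    obtain d Q where m: "m = (d, Q)" by force
    obtain S U where S: "F d P Q S U" "apply_moves F ms S T" using Cons(2) m by auto
    then show ?case using Cons(1)[OF S(2)] op_within[OF S(1)] m by simp
  qed simp
  then show "snd ` set ms \<subseteq> tableaux_within l" and "P \<in> tableaux_within l \<Longrightarrow> T \<in> tableaux_within l"
    by blast+
qed

lemma apply_moves_kl:
  assumes "apply_moves F ms P T" "P \<in> tableaux_kl k l"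
  shows "T \<in> tableaux_kl k l"
  using assms
proof (induction ms arbitrary: P)
  case (Cons m ms)
  obtain d Q where m: "m = (d, Q)" by force
  obtain S U where S: "F d P Q S U" "apply_moves F ms S T" using Cons m by auto
  have "S \<in> tableaux_kl k l"
    using op_within[OF S(1)] op_length[OF S(1)] Cons(3) by (simp add: tableaux_kl_def)
  then show ?case using Cons(1) S(2) by blast
qed simp

text \<open>The first move absorbs the shift of its argument, after which both sequences can pass
  through the same tableaux. For the empty sequence the shift remains, whence the conclusion up to
  shift.\<close>

lemma apply_moves_shift:
  assumes "apply_moves F ms P T" "shift_eq l P P'"
    and "list_all2 (\<lambda>m m'. fst m = fst m' \<and> shift_eq l (snd m) (snd m')) ms ms'"
  shows "\<exists>T'. apply_moves F ms' P' T' \<and> shift_eq l T T'"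
  using assms
proof (induction ms arbitrary: P P' ms')
  case (Cons m ms)
  obtain d Q where m: "m = (d, Q)" by force
  then obtain Q' ns where ms': "ms' = (d, Q') # ns" "shift_eq l Q Q'"
      "list_all2 (\<lambda>m m'. fst m = fst m' \<and> shift_eq l (snd m) (snd m')) ms ns"
    using Cons(4) by (auto simp: list_all2_Cons1)
  obtain S U where S: "F d P Q S U" "apply_moves F ms S T" using Cons m by auto
  have "F d P' Q' S U" using op_shift[OF S(1) Cons(3) ms'(2)] by simp
  then show ?case using Cons(1)[OF S(2) _ ms'(3), of S] ms'(1) by auto
qed simp

lemma apply_refine_moves:
  assumes "apply_moves F ms P T"
  shows "apply_moves F (refine_moves k ms) P T"
  using assms
proof (induction ms arbitrary: P)
  case (Cons m ms)
  then show ?case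
    by (cases m) (auto simp: refine_moves_def apply_moves_append dest: op_split)
qed (simp add: refine_moves_def)

lemma refine_moves_kl:
  assumes "snd ` set ms \<subseteq> tableaux_within l"
  shows "snd ` set (refine_moves k ms) \<subseteq> tableaux_kl k l"
proof -
  have piece: "snd ` set (piece_moves k d Q) \<subseteq> tableaux_kl k l" if "Q \<in> tableaux_within l" for d Q
    using pieces_subset[OF that k_pos] by (cases d) auto
  show ?thesis
    using assms
  proof (induction ms)
    case (Cons m ms)
    then show ?case by (cases m) (simp add: refine_moves_def image_Un piece)
  qed (simp add: refine_moves_def)
qed

text \<open>The refined sequence reaches the same \<open>T\<close> by moves of fixed length, to
  which the hypothesis applies. For \<open>P'\<close> this yields existence of the refined moves
  only; passing back to \<open>ms\<close> is the task of \<open>op_join\<close>.\<close>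

lemma dual_equivalent_kl_refined:
  assumes "dual_equivalent_kl k l F P P'" "apply_moves F ms P T"
  shows "\<exists>T'. apply_moves F (refine_moves k ms) P' T'"
    and "apply_moves F ms P' T' \<Longrightarrow> same_shape l T T'"
  using assms apply_refine_moves refine_moves_kl[OF apply_moves_within(1)[OF assms(2)]]
  unfolding dual_equivalent_kl_def by meson+

lemma dual_equivalent_kl_moves:
  assumes dual: "dual_equivalent_kl k l F P P'" and P': "P' \<in> tableaux_within l"
    and "apply_moves F ms P T"
  shows "\<exists>T'. apply_moves F ms P' T'"
  using op_join
proof
  assume join: "\<forall>d P Q T. Q \<in> tableaux_within l \<and> apply_moves F (piece_moves k d Q) P T \<longrightarrow> (\<exists>U. F d P Q T U)"
  \<comment> \<open>Insertion: the pieces of each move are glued back together.\<close>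
  have "apply_moves F ms S T'" if "snd ` set ms \<subseteq> tableaux_within l" "apply_moves F (refine_moves k ms) S T'" for S T'
    using that
  proof (induction ms arbitrary: S)
    case (Cons m ms)
    then show ?case
      using join by (cases m) (fastforce simp: refine_moves_def apply_moves_append)
  qed (simp add: refine_moves_def)
  then show ?thesis
    using dual_equivalent_kl_refined(1)[OF dual assms(3)] apply_moves_within(1)[OF assms(3)] by blast
next
  assume join: "\<forall>d P P' Q T U. F d P Q T U \<and> P' \<in> tableaux_within l \<and> same_shape l P P' \<longrightarrow>
    (\<exists>T' U'. F d P' Q T' U')"
  \<comment> \<open>Switching: the tableaux reached so far have the same shape, so the next move
    exists for both.\<close>
  show ?thesis
    using assms(3)
  proof (induction ms arbitrary: T rule: rev_induct)
    case (snoc m ms)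
    obtain d Q where m: "m = (d, Q)" by force
    obtain S U where S: "apply_moves F ms P S" "F d S Q T U"
      using snoc(2) m by (auto simp: apply_moves_append)
    obtain S' where S': "apply_moves F ms P' S'" using snoc(1)[OF S(1)] by blast
    have "same_shape l S S'" using dual_equivalent_kl_refined(2)[OF dual S(1) S'] .
    then obtain T' U' where "F d S' Q T' U'"
      using join S(2) apply_moves_within(2)[OF S' P'] by blast
    then show ?case using S' m by (auto simp: apply_moves_append)
  qed (auto intro: exI[of _ P'])
qed

lemma dual_equivalent_iff_kl:
  assumes "P \<in> tableaux_within l" "P' \<in> tableaux_within l"
  shows "dual_equivalent l F P P' \<longleftrightarrow> dual_equivalent_kl k l F P P'"
proof
  assume "dual_equivalent l F P P'"
  then show "dual_equivalent_kl k l F P P'"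
    unfolding dual_equivalent_def dual_equivalent_kl_def by blast
next
  assume dual: "dual_equivalent_kl k l F P P'"
  have "same_shape l P P'" using dual unfolding dual_equivalent_kl_def by blast
  then show "dual_equivalent l F P P'"
    unfolding dual_equivalent_def
    using dual_equivalent_kl_moves[OF dual assms(2)]
      dual_equivalent_kl_moves[OF dual_equivalent_kl_sym[OF dual] assms(1)]
      dual_equivalent_kl_refined(2)[OF dual] by blast
qed

section \<open>Moves of the complementary operation\<close>

definition complement_moves :: "(direction \<times> tab) list \<Rightarrow> (direction \<times> tab) list" where
  "complement_moves ms = map (\<lambda>(d, Q). (d, complement k l Q)) ms"

lemma complement_moves_kl:
  "snd ` set ms \<subseteq> tableaux_kl k l \<Longrightarrow> snd ` set (complement_moves ms) \<subseteq> tableaux_kl k l"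
  by (induction ms) (auto simp: complement_moves_def complement_kl)

lemma shift_eq_complement_complement:
  assumes "Q \<in> tableaux_kl k l"
  shows "shift_eq l Q (complement k l (complement k l Q))"
  using assms by (simp add: complement_complement kl_length)

lemma complement_moves_complement_moves:
  assumes "snd ` set ms \<subseteq> tableaux_kl k l"
  shows "list_all2 (\<lambda>m m'. fst m = fst m' \<and> shift_eq l (snd m) (snd m')) ms
      (complement_moves (complement_moves ms))"
  using assms shift_eq_complement_complement
  by (induction ms) (auto simp: complement_moves_def)

lemma moves_shift_sym:
  assumes "list_all2 (\<lambda>m m'. fst m = fst m' \<and> shift_eq l (snd m) (snd m')) ms ms'"
  shows "list_all2 (\<lambda>m m'. fst m = fst m' \<and> shift_eq l (snd m) (snd m')) ms' ms"
  using assms by (induction ms ms' rule: list_all2_induct) (auto intro: shift_eq_sym)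

lemma moves_shift_refl:
  "list_all2 (\<lambda>m m'. fst m = fst m' \<and> shift_eq l (snd m) (snd m')) ms ms"
  by (simp add: list_all2_refl)

text \<open>A complement to accompany \<open>T\<close> exists for every \<open>U\<close>, so a
  complementary move is exactly an \<open>F\<close>-move along a complement.\<close>

lemma apply_complementary_moves:
  "apply_moves (complementary_op k l F) ms P T \<longleftrightarrow>
     snd ` set ms \<subseteq> tableaux_kl k l \<and> apply_moves F (complement_moves ms) P T"
proof (induction ms arbitrary: P)
  case (Cons m ms)
  obtain d Q where m: "m = (d, Q)" by force
  have "(\<exists>V. complementary_op k l F d P Q S V) \<longleftrightarrow>
      Q \<in> tableaux_kl k l \<and> (\<exists>U. F d P (complement k l Q) S U)" for S
    unfolding complementary_op_def using shift_eq_refl by blast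
  then show ?case
    using Cons m by (auto simp: complement_moves_def)
qed (auto simp: complement_moves_def)

text \<open>Complements have length \<open>k + 1\<close>, so complementary moves are among the
  restricted \<open>F\<close>-moves. Conversely every tableau of that length is, up to shift, the
  complement of its own complement.\<close>

lemma dual_equivalent_complementary_iff:
  assumes "P \<in> tableaux_within l" "P' \<in> tableaux_within l"
  shows "dual_equivalent l (complementary_op k l F) P P' \<longleftrightarrow> dual_equivalent_kl k l F P P'"
proof
  assume "dual_equivalent_kl k l F P P'"
  then show "dual_equivalent l (complementary_op k l F) P P'"
    unfolding dual_equivalent_def dual_equivalent_kl_def apply_complementary_moves
    using complement_moves_kl by blast
next
  assume dual: "dual_equivalent l (complementary_op k l F) P P'"
  \<comment> \<open>The sequence \<open>ms\<close> is simulated by complementary moves along its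
    complements; since complementing twice shifts, the result is a shift of
    \<open>T\<close>.\<close>
  have to: "\<exists>T'. apply_moves (complementary_op k l F) (complement_moves ms) R T' \<and> shift_eq l T T'"
    if "apply_moves F ms R T" "snd ` set ms \<subseteq> tableaux_kl k l" for ms R T
    using apply_moves_shift[OF that(1) _ complement_moves_complement_moves[OF that(2)], of R]
      complement_moves_kl[OF that(2)] unfolding apply_complementary_moves by auto
  \<comment> \<open>Existence suffices on the way back, as shapes are compared through
    \<open>to\<close>.\<close>
  have fro: "\<exists>T'. apply_moves F ms R T'"
    if "apply_moves (complementary_op k l F) (complement_moves ms) R T" "snd ` set ms \<subseteq> tableaux_kl k l" for ms R T
    using apply_moves_shift[OF _ _ moves_shift_sym[OF complement_moves_complement_moves[OF that(2)]], of R T R]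
      that(1) unfolding apply_complementary_moves by auto
  show "dual_equivalent_kl k l F P P'"
    unfolding dual_equivalent_kl_def
  proof (intro conjI allI impI)
    show "same_shape l P P'" using dual unfolding dual_equivalent_def by blast
    fix ms :: "(direction \<times> tab) list" assume ms: "snd ` set ms \<subseteq> tableaux_kl k l"
    show "(\<exists>T. apply_moves F ms P T) \<longleftrightarrow> (\<exists>T'. apply_moves F ms P' T')"
      using to[OF _ ms] fro[OF _ ms] dual unfolding dual_equivalent_def by meson
    fix T T' assume T: "apply_moves F ms P T \<and> apply_moves F ms P' T'"
    obtain S S' where S: "shift_eq l T S" "shift_eq l T' S'" "same_shape l S S'"
      using T to[OF _ ms] dual unfolding dual_equivalent_def by meson
    have "T \<noteq> []" "T' \<noteq> []"
      using T assms apply_moves_within(2) by (auto simp: tableaux_within_iff)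
    then show "same_shape l T T'"
      using S shift_eq_same_shape same_shape_trans same_shape_sym by meson
  qed
qed

text \<open>Complementing a tableau twice returns a shift of it; this lemma removes that shift from
  an equivalence.\<close>

lemma dual_equivalent_kl_shift:
  assumes "dual_equivalent_kl k l F P Q" "shift_eq l P P'" "shift_eq l Q Q'"
    and "P \<in> tableaux_within l" "Q \<in> tableaux_within l"
  shows "dual_equivalent_kl k l F P' Q'"
proof -
  have shape: "same_shape l S' T'"
    if "same_shape l S T" "shift_eq l S S'" "shift_eq l T T'" "S \<in> tableaux_within l" "T \<in> tableaux_within l" for S T S' T'
  proof -
    have "S \<noteq> []" "T \<noteq> []" using that by (auto simp: tableaux_within_iff)
    then show ?thesis using that shift_eq_same_shape same_shape_trans same_shape_sym by meson
  qed
  have to: "\<exists>T. apply_moves F ms R' T \<and> shift_eq l T' T" if "shift_eq l R R'" "apply_moves F ms R T'" for R R' ms T'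
    using apply_moves_shift[OF that(2,1) moves_shift_refl] .
  show ?thesis
    unfolding dual_equivalent_kl_def
  proof (intro conjI allI impI)
    show "same_shape l P' Q'" using shape assms unfolding dual_equivalent_kl_def by blast
    fix ms :: "(direction \<times> tab) list" assume ms: "snd ` set ms \<subseteq> tableaux_kl k l"
    show "(\<exists>T. apply_moves F ms P' T) \<longleftrightarrow> (\<exists>T'. apply_moves F ms Q' T')"
      using to assms(1-3) shift_eq_sym ms unfolding dual_equivalent_kl_def by meson
    fix T T' assume T: "apply_moves F ms P' T \<and> apply_moves F ms Q' T'"
    obtain S where S: "apply_moves F ms P S" "shift_eq l T S"
      using to[OF shift_eq_sym[OF assms(2)]] T by blast
    obtain S' where S': "apply_moves F ms Q S'" "shift_eq l T' S'"
      using to[OF shift_eq_sym[OF assms(3)]] T by blast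
    have "same_shape l S S'" using S S' assms(1) ms unfolding dual_equivalent_kl_def by blast
    then show "same_shape l T T'"
      using shape S S' shift_eq_sym apply_moves_within(2) assms(4,5) by meson
  qed
qed

text \<open>Complementation exchanges inner and outer borders, so an array completed from one pair
  of sides becomes one completed from the opposite pair. This is why directions change.\<close>

definition reverse_moves :: "(direction \<times> tab) list \<Rightarrow> (direction \<times> tab) list" where
  "reverse_moves ms = map (\<lambda>(d, Q). (opposite d, complement k l Q)) ms"

section \<open>Complementing whole sequences under the symmetry condition\<close>

context
  assumes complement_symmetric:
    "\<lbrakk>P \<in> tableaux_kl k l; Q \<in> tableaux_kl k l; T \<in> tableaux_kl k l; U \<in> tableaux_kl k l; F d P Q T U\<rbrakk>
      \<Longrightarrow> F (opposite d) (complement k l P) (complement k l Q) (complement k l T) (complement k l U)"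
begin

text \<open>Moves preserve the length and the column bound, so the symmetry is available at each
  intermediate tableau.\<close>

lemma apply_reverse_moves:
  assumes "apply_moves F ms P T" "P \<in> tableaux_kl k l" "snd ` set ms \<subseteq> tableaux_kl k l"
  shows "apply_moves F (reverse_moves ms) (complement k l P) (complement k l T)"
  using assms
proof (induction ms arbitrary: P)
  case (Cons m ms)
  obtain d Q where m: "m = (d, Q)" by force
  obtain S U where S: "F d P Q S U" "apply_moves F ms S T" using Cons m by auto
  have kl: "Q \<in> tableaux_kl k l" using Cons(4) m by simp
  then have "S \<in> tableaux_kl k l" "U \<in> tableaux_kl k l"
    using op_within[OF S(1)] op_length[OF S(1)] Cons(3) by (simp_all add: tableaux_kl_def)
  then show ?case
    using complement_symmetric[OF Cons(3) kl _ _ S(1)] Cons(1)[OF S(2)] Cons(4) m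
    by (auto simp: reverse_moves_def)
qed (simp add: reverse_moves_def)

text \<open>A sequence from the complement of \<open>P\<close> is complemented once more and becomes
  a sequence from a shift of \<open>P\<close>, where \<open>dual\<close> applies. Complements have
  the same shape exactly when the originals do.\<close>

lemma dual_equivalent_kl_complement:
  assumes dual: "dual_equivalent_kl k l F P Q" and P: "P \<in> tableaux_kl k l" and Q: "Q \<in> tableaux_kl k l"
  shows "dual_equivalent_kl k l F (complement k l P) (complement k l Q)"
proof -
  have kl: "snd ` set (reverse_moves ms) \<subseteq> tableaux_kl k l" if "snd ` set ms \<subseteq> tableaux_kl k l" for ms :: "(direction \<times> tab) list"
    using that by (induction ms) (auto simp: reverse_moves_def complement_kl)
  have opp: "opposite (opposite d) = d" for d by (cases d) simp_all
  have twice: "list_all2 (\<lambda>m m'. fst m = fst m' \<and> shift_eq l (snd m) (snd m'))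
      (reverse_moves (reverse_moves ms)) ms" if "snd ` set ms \<subseteq> tableaux_kl k l" for ms
    using that shift_eq_complement_complement
    by (induction ms) (auto simp: reverse_moves_def opp intro: shift_eq_sym)
  \<comment> \<open>The complemented sequence starts from the double complement of \<open>R\<close>;
    moving its start to \<open>R\<close> costs a shift of the result.\<close>
  have down: "\<exists>T'. apply_moves F (reverse_moves ms) R T' \<and> shift_eq l (complement k l T) T'"
    if "apply_moves F ms (complement k l R) T" "snd ` set ms \<subseteq> tableaux_kl k l" "R \<in> tableaux_kl k l" for ms R T
    using apply_moves_shift[OF apply_reverse_moves[OF that(1) complement_kl[OF that(3)] that(2)] _ moves_shift_refl]
      shift_eq_complement_complement[OF that(3)] shift_eq_sym by blast
  \<comment> \<open>Complementing the moves from \<open>R\<close> leads to a doubly complemented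
    sequence, which is a shift of \<open>ms\<close>.\<close>
  have up: "\<exists>T. apply_moves F ms (complement k l R) T"
    if "apply_moves F (reverse_moves ms) R T'" "snd ` set ms \<subseteq> tableaux_kl k l" "R \<in> tableaux_kl k l" for ms R T'
    using apply_moves_shift[OF apply_reverse_moves[OF that(1,3) kl[OF that(2)]] shift_eq_refl twice[OF that(2)]] by blast
  show ?thesis
    unfolding dual_equivalent_kl_def
  proof (intro conjI allI impI)
    show "same_shape l (complement k l P) (complement k l Q)"
      using dual P Q by (simp add: same_shape_complement kl_length dual_equivalent_kl_def)
    fix ms :: "(direction \<times> tab) list" assume ms: "snd ` set ms \<subseteq> tableaux_kl k l"
    show "(\<exists>T. apply_moves F ms (complement k l P) T) \<longleftrightarrow> (\<exists>T'. apply_moves F ms (complement k l Q) T')"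
      using down[OF _ ms P] down[OF _ ms Q] up[OF _ ms P] up[OF _ ms Q] dual kl[OF ms]
      unfolding dual_equivalent_kl_def by meson
    fix T T' assume T: "apply_moves F ms (complement k l P) T \<and> apply_moves F ms (complement k l Q) T'"
    then have TT: "T \<in> tableaux_kl k l" "T' \<in> tableaux_kl k l"
      using apply_moves_kl complement_kl P Q by blast+
    obtain S S' where S: "apply_moves F (reverse_moves ms) P S" "shift_eq l (complement k l T) S"
      "apply_moves F (reverse_moves ms) Q S'" "shift_eq l (complement k l T') S'"
      using down[OF _ ms P] down[OF _ ms Q] T by meson
    have "same_shape l S S'" using S dual kl[OF ms] unfolding dual_equivalent_kl_def by blast
    moreover have "complement k l T \<noteq> []" "complement k l T' \<noteq> []" by (simp_all add: complement_def)
    ultimately have "same_shape l (complement k l T) (complement k l T')"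
      using S shift_eq_same_shape same_shape_trans same_shape_sym by meson
    then show "same_shape l T T'"
      using TT by (simp add: same_shape_complement kl_length)
  qed
qed

lemma dual_equivalent_complement_iff:
  assumes P: "P \<in> tableaux_kl k l" and Q: "Q \<in> tableaux_kl k l"
  shows "dual_equivalent l F P Q \<longleftrightarrow> dual_equivalent l F (complement k l P) (complement k l Q)"
proof -
  let ?C = "complement k l"
  \<comment> \<open>The converse is the same lemma for the complements, followed by removal of the
    double complements.\<close>
  have "dual_equivalent_kl k l F P Q" if "dual_equivalent_kl k l F (?C P) (?C Q)"
    using dual_equivalent_kl_shift[OF dual_equivalent_kl_complement[OF that]]
      complement_kl P Q kl_within shift_eq_sym shift_eq_complement_complement by meson
  then show ?thesis
    using dual_equivalent_kl_complement P Q complement_kl dual_equivalent_iff_kl kl_within by meson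
qed

end

end

section \<open>The operations of local rules\<close>

lemma switching_op_transports:
  "(\<exists>U. switching_op l L Forward P Q T U) \<longleftrightarrow> transports l (switching_cell L) last P Q T"
  "(\<exists>U. switching_op l L Backward P Q T U) \<longleftrightarrow> transports l (switching_cell L) hd T Q P"
  using up_to_shift_transports[of hd l "switching_cell L" last P Q T]
    up_to_shift_transports[of last l "switching_cell L" hd T Q P]
    up_to_shift_swap[of l "switching_cell L" last hd T _ P Q]
  by (simp_all add: switching_array_eq)

lemma insertion_op_transports:
  "(\<exists>U. insertion_op l L Forward P Q T U) \<longleftrightarrow> transports l (insertion_cell L) hd P Q T"
  "(\<exists>U. insertion_op l L Backward P Q T U) \<longleftrightarrow> transports l (insertion_cell L) last T Q P"
  using up_to_shift_transports[of last l "insertion_cell L" hd P Q T]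
    up_to_shift_transports[of hd l "insertion_cell L" last T Q P]
    up_to_shift_swap[of l "insertion_cell L" hd last T _ P Q]
  by (simp_all add: insertion_array_eq)

lemma tableaux_operation_switching:
  assumes "0 < k" and L: "switching_rule L"
  shows "tableaux_operation k l (switching_op l L)"
proof
  show "0 < k" by fact
next
  fix d P Q T U assume F: "switching_op l L d P Q T U"
  show "{P, Q, T, U} \<subseteq> tableaux_within l"
    using F by (cases d) (auto simp: up_to_shift_def)
  show "length T = length P \<and> length U = length Q"
    using F by (cases d) (auto simp: switching_array_eq dest: up_to_shift_length)
  show "switching_op l L d P' Q' T' U'"
    if "shift_eq l P P'" "shift_eq l Q Q'" "shift_eq l T T'" "shift_eq l U U'" for P' Q' T' U'
    using F up_to_shift_cong that by (cases d) auto
  show "apply_moves (switching_op l L) (piece_moves k d Q) P T"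
  proof (cases d)
    case Forward
    then have "transports l (switching_cell L) last P Q T"
      using F switching_op_transports(1) by blast
    from pieces_transports[OF switching_cell_refl[OF L] _ assms(1) this] Forward
    show ?thesis by (simp add: apply_moves_chained switching_op_transports del: switching_op.simps)
  next
    case Backward
    then have "transports l (switching_cell L) hd T Q P"
      using F switching_op_transports(2) by blast
    from pieces_transports[OF switching_cell_refl[OF L] _ assms(1) this] Backward
    show ?thesis
      by (simp add: apply_moves_chained chained_rev switching_op_transports del: switching_op.simps)
  qed
next
  \<comment> \<open>This is the second half of the disjunction: \<open>P'\<close> inherits the
    border condition of \<open>P\<close>, at shift amounts composed from both relations.\<close>
  have "\<exists>T' U'. switching_op l L d P' Q T' U'"
    if F: "switching_op l L d P Q T U" and w: "P' \<in> tableaux_within l" and shape: "same_shape l P P'" for d P P' Q T U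
  proof -
    obtain a b where ab: "prepend l a (hd P) = prepend l b (hd P')" "prepend l a (last P) = prepend l b (last P')"
      using shape unfolding same_shape_def by blast
    show ?thesis
    proof (cases d)
      case Forward
      then have tr: "transports l (switching_cell L) last P Q T"
        using F switching_op_transports(1) by blast
      obtain i j where "prepend l i (last P) = prepend l j (hd Q)"
        using transports_borders(1)[OF tr] by blast
      then have "prepend l (i + b) (last P') = prepend l (a + j) (hd Q)"
        using ab(2) by (metis prepend_prepend add.commute)
      then have "\<exists>T'. transports l (switching_cell L) last P' Q T'"
        using switching_transports_down[OF L w] tr unfolding transports_def by blast
      then show ?thesis using Forward switching_op_transports(1) by blast
    next
      case Backward
      then have tr: "transports l (switching_cell L) hd T Q P"
        using F switching_op_transports(2) by blast
      obtain i j where "prepend l i (hd P) = prepend l j (last Q)"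
        using transports_borders(2)[OF tr] by blast
      then have "prepend l (i + b) (hd P') = prepend l (a + j) (last Q)"
        using ab(1) by (metis prepend_prepend add.commute)
      then have "\<exists>T'. transports l (switching_cell L) hd T' Q P'"
        using switching_transports_up[OF L w] tr unfolding transports_def by blast
      then show ?thesis using Backward switching_op_transports(2) by blast
    qed
  qed
  then show "(\<forall>d P Q T. Q \<in> tableaux_within l \<and> apply_moves (switching_op l L) (piece_moves k d Q) P T \<longrightarrow>
        (\<exists>U. switching_op l L d P Q T U)) \<or>
      (\<forall>d P P' Q T U. switching_op l L d P Q T U \<and> P' \<in> tableaux_within l \<and> same_shape l P P' \<longrightarrow>
        (\<exists>T' U'. switching_op l L d P' Q T' U'))"
    by blast
qed

text \<open>Backward moves do not occur, and forward moves agree with those of the two-sided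
  operation, whose properties carry over.\<close>

lemma tableaux_operation_outward_switching:
  assumes "0 < k" and L: "switching_rule L"
  shows "tableaux_operation k l (outward_switching_op l L)"
proof -
  interpret sw: tableaux_operation k l "switching_op l L"
    using tableaux_operation_switching[OF assms] .
  have moves: "apply_moves (outward_switching_op l L) (map (Pair Forward) Qs) P T \<longleftrightarrow>
      apply_moves (switching_op l L) (map (Pair Forward) Qs) P T" for Qs P T
    by (simp add: apply_moves_chained outward_switching_op_def)
  \<comment> \<open>\<open>sw.op_join\<close> is a disjunction that does not tell which half holds,
    so the half for switching is derived directly for forward moves.\<close>
  have total: "\<exists>T' U'. switching_op l L Forward P' Q T' U'"
    if F: "switching_op l L Forward P Q T U" and w: "P' \<in> tableaux_within l" and shape: "same_shape l P P'" for P P' Q T U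
  proof -
    have tr: "transports l (switching_cell L) last P Q T"
      using F switching_op_transports(1) by blast
    obtain a b where ab: "prepend l a (last P) = prepend l b (last P')"
      using shape unfolding same_shape_def by blast
    obtain i j where "prepend l i (last P) = prepend l j (hd Q)"
      using transports_borders(1)[OF tr] by blast
    then have "prepend l (i + b) (last P') = prepend l (a + j) (hd Q)"
      using ab by (metis prepend_prepend add.commute)
    then have "\<exists>T'. transports l (switching_cell L) last P' Q T'"
      using switching_transports_down[OF L w] tr unfolding transports_def by blast
    then show ?thesis using switching_op_transports(1) by blast
  qed
  show ?thesis
  proof
    show "0 < k" by fact
  next
    fix d P Q T U assume "outward_switching_op l L d P Q T U"
    then have F: "switching_op l L d P Q T U" "d = Forward" by (auto simp: outward_switching_op_def)
    show "{P, Q, T, U} \<subseteq> tableaux_within l" using sw.op_within[OF F(1)] .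
    show "length T = length P \<and> length U = length Q" using sw.op_length[OF F(1)] .
    show "outward_switching_op l L d P' Q' T' U'"
      if "shift_eq l P P'" "shift_eq l Q Q'" "shift_eq l T T'" "shift_eq l U U'" for P' Q' T' U'
      using sw.op_shift[OF F(1) that] F(2) by (simp add: outward_switching_op_def)
    show "apply_moves (outward_switching_op l L) (piece_moves k d Q) P T"
      using sw.op_split[OF F(1)] F(2) by (simp add: moves)
  next
    show "(\<forall>d P Q T. Q \<in> tableaux_within l \<and>
          apply_moves (outward_switching_op l L) (piece_moves k d Q) P T \<longrightarrow>
          (\<exists>U. outward_switching_op l L d P Q T U)) \<or>
        (\<forall>d P P' Q T U. outward_switching_op l L d P Q T U \<and> P' \<in> tableaux_within l \<and>
          same_shape l P P' \<longrightarrow> (\<exists>T' U'. outward_switching_op l L d P' Q T' U'))"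
      using total unfolding outward_switching_op_def by blast
  qed
qed

lemma tableaux_operation_insertion:
  assumes "0 < k" and L: "insertion_rule L"
  shows "tableaux_operation k l (insertion_op l L)"
proof
  show "0 < k" by fact
next
  fix d P Q T U assume F: "insertion_op l L d P Q T U"
  show "{P, Q, T, U} \<subseteq> tableaux_within l"
    using F by (cases d) (auto simp: up_to_shift_def)
  show "length T = length P \<and> length U = length Q"
    using F by (cases d) (auto simp: insertion_array_eq dest: up_to_shift_length)
  show "insertion_op l L d P' Q' T' U'"
    if "shift_eq l P P'" "shift_eq l Q Q'" "shift_eq l T T'" "shift_eq l U U'" for P' Q' T' U'
    using F up_to_shift_cong that by (cases d) auto
  show "apply_moves (insertion_op l L) (piece_moves k d Q) P T"
  proof (cases d)
    case Forward
    then have "transports l (insertion_cell L) hd P Q T"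
      using F insertion_op_transports(1) by blast
    from pieces_transports[OF insertion_cell_refl[OF L] _ assms(1) this] Forward
    show ?thesis by (simp add: apply_moves_chained insertion_op_transports del: insertion_op.simps)
  next
    case Backward
    then have "transports l (insertion_cell L) last T Q P"
      using F insertion_op_transports(2) by blast
    from pieces_transports[OF insertion_cell_refl[OF L] _ assms(1) this] Backward
    show ?thesis
      by (simp add: apply_moves_chained chained_rev insertion_op_transports del: insertion_op.simps)
  qed
next
  \<comment> \<open>This is the first half of the disjunction: compatibility with prepending lets
    the arrays of the pieces be glued.\<close>
  have "\<exists>U. insertion_op l L d P Q T U"
    if Q: "Q \<in> tableaux_within l" and F: "apply_moves (insertion_op l L) (piece_moves k d Q) P T" for d P Q T
  proof -
    have "Q \<noteq> []" using Q by (simp add: tableaux_within_iff)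
    \<comment> \<open>The column selector stays schematic, to be \<open>hd\<close> for forward and
      \<open>last\<close> for backward moves.\<close>
    note tr = transports_pieces[of "insertion_cell L" l _ k Q,
        OF insertion_cell_refl[OF L] insertion_cell_case_nat[OF L] _ assms(1) this]
    show ?thesis
    proof (cases d)
      case Forward
      then have "transports l (insertion_cell L) hd P Q T"
        using F by (intro tr) (simp_all add: apply_moves_chained insertion_op_transports del: insertion_op.simps)
      then show ?thesis using Forward insertion_op_transports(1) by blast
    next
      case Backward
      then have "transports l (insertion_cell L) last T Q P"
        using F by (intro tr)
          (simp_all add: apply_moves_chained chained_rev insertion_op_transports del: insertion_op.simps)
      then show ?thesis using Backward insertion_op_transports(2) by blast
    qed
  qed
  then show "(\<forall>d P Q T. Q \<in> tableaux_within l \<and> apply_moves (insertion_op l L) (piece_moves k d Q) P T \<longrightarrow>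
        (\<exists>U. insertion_op l L d P Q T U)) \<or>
      (\<forall>d P P' Q T U. insertion_op l L d P Q T U \<and> P' \<in> tableaux_within l \<and> same_shape l P P' \<longrightarrow>
        (\<exists>T' U'. insertion_op l L d P' Q T' U'))"
    by blast
qed

theorem theorem3p2:
  fixes k l :: nat and F :: operation
  assumes "0 < k"
    and "local_rule_operation l F"
  shows "(well_defined_op l (complementary_op k l F) \<longrightarrow>
           (\<forall>P\<in>tableaux_within l. \<forall>Q\<in>tableaux_within l.
              dual_equivalent l F P Q \<longleftrightarrow> dual_equivalent l (complementary_op k l F) P Q)) \<and>
         ((\<forall>d. \<forall>P\<in>tableaux_kl k l. \<forall>Q\<in>tableaux_kl k l. \<forall>T\<in>tableaux_kl k l. \<forall>U\<in>tableaux_kl k l.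
              F d P Q T U \<longleftrightarrow>
              F (opposite d) (complement k l P) (complement k l Q) (complement k l T) (complement k l U)) \<longrightarrow>
           (\<forall>P\<in>tableaux_kl k l. \<forall>Q\<in>tableaux_kl k l.
              dual_equivalent l F P Q \<longleftrightarrow> dual_equivalent l F (complement k l P) (complement k l Q)))"
proof -
  have "tableaux_operation k l F"
    using assms(2) unfolding local_rule_operation_def
    by (elim disjE exE conjE)
      (simp_all only: assms(1) tableaux_operation_switching tableaux_operation_outward_switching
        tableaux_operation_insertion)
  then interpret tableaux_operation k l F .
  show ?thesis
  proof (intro conjI impI ballI)
    fix P Q assume "P \<in> tableaux_within l" "Q \<in> tableaux_within l"
    \<comment> \<open>Both sides coincide with \<open>dual_equivalent_kl k l F\<close>.\<close>
    then show "dual_equivalent l F P Q \<longleftrightarrow> dual_equivalent l (complementary_op k l F) P Q"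
      by (simp add: dual_equivalent_iff_kl dual_equivalent_complementary_iff)
  next
    fix P Q
    assume "\<forall>d. \<forall>P\<in>tableaux_kl k l. \<forall>Q\<in>tableaux_kl k l. \<forall>T\<in>tableaux_kl k l. \<forall>U\<in>tableaux_kl k l.
        F d P Q T U \<longleftrightarrow>
        F (opposite d) (complement k l P) (complement k l Q) (complement k l T) (complement k l U)"
      and PQ: "P \<in> tableaux_kl k l" "Q \<in> tableaux_kl k l"
    then show "dual_equivalent l F P Q \<longleftrightarrow> dual_equivalent l F (complement k l P) (complement k l Q)"
      by (intro dual_equivalent_complement_iff[OF _ PQ]) blast
  qed
qed

end
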